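(* Let $\pi$ be an optimal transport plan between $\mu,\nu \in \mathcal P_1(\mathbb R^n)$ for the $1$-Wasserstein distance on $\mathbb R^n$. Then the support of $\pi$ is contained within a closed $(n+1)$-rectifiable set, which can be taken to be the stretch set $\mathbf\Gamma(f)$ of any associated Kantorovich potential $f$. In particular, the support of $\pi$ has Hausdorff dimension at most $n+1$.
   Context: $\mathcal P_1(\mathbb R^n)$ is the space of probability measures $\eta$ on $\mathbb R^n$ whose first moment $\int_{\mathbb R^n} |x|\,d\eta(x)$ is finite. A coupling (transport plan) of $\mu,\nu$ is a probability measure $\pi$ on $\mathbb R^n\times\mathbb R^n$ with $\pi(E\times\mathbb R^n)=\mu(E)$ and $\pi(\mathbb R^n\times E)=\nu(E)$ for all Borel $E\subseteq\mathbb R^n$. It is optimal for the $1$-Wasserstein distance if it minimizes $\int_{\mathbb R^n\times\mathbb R^n} |x-y|\,d\pi(x,y)$ among all couplings of $\mu,\nu$. For a Lipschitz function $u:\mathbb R^n\to\mathbb R$, $\operatorname{Lip}(u)$ denotes its best Lipschitz constant, i.e. the infimum of all $L>0$ such that $|u(x)-u(y)|\le L|x-y|$ for all $x,y$. The stretch set of $u$ is $$\mathbf\Gamma(u) := \{(x,y)\in\mathbb R^n\times\mathbb R^n : |u(x)-u(y)| = \operatorname{Lip}(u)\,|x-y|\}.$$ By Kantorovich duality, to every optimal plan $\pi$ there is associated a Kantorovich potential, a $1$-Lipschitz function $f:\mathbb R^n\to\mathbb R$ such that $\pi(\mathbf\Gamma(f)) = 1$. Let $E$ be an arbitrary subset of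 $\mathbb R^d$ and $k<d$ a nonzero integer. $E$ is $k$-rectifiable if there exist countably many Lipschitz maps $\psi_i:\mathbb R^k\to\mathbb R^d$ such that $E\subseteq\bigcup_i\psi_i(\mathbb R^k)$ (no exceptional $\mathcal H^k$-null set is allowed to be omitted). The sets here are subsets of $\mathbb R^n\times\mathbb R^n=\mathbb R^{2n}$.
   Formalization: Rectifiability of the stretch set is claimed only for non-constant potentials f: a constant f satisfies the definition of a potential with Lip(f) = 0, and its stretch set is all of R^{2n}, which is not (n+1)-rectifiable for n ≥ 2. *)

theory Defs
  imports "HOL-Probability.Probability"
begin

definition P1 :: "'a::euclidean_space measure set" where
  "P1 = {\<eta>. prob_space \<eta> \<and> sets \<eta> = sets borel \<and> (\<integral>\<^sup>+ x. ennreal (norm x) \<partial>\<eta>) < \<infinity>}"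

definition coupling ::
    "('a::euclidean_space \<times> 'a) measure \<Rightarrow> 'a measure \<Rightarrow> 'a measure \<Rightarrow> bool" where
  "coupling \<pi> \<mu> \<nu> \<longleftrightarrow> prob_space \<pi> \<and> sets \<pi> = sets borel \<and>
     (\<forall>E\<in>sets borel. emeasure \<pi> (E \<times> UNIV) = emeasure \<mu> E \<and>
                     emeasure \<pi> (UNIV \<times> E) = emeasure \<nu> E)"

definition W1_cost :: "('a::euclidean_space \<times> 'a) measure \<Rightarrow> ennreal" where
  "W1_cost \<pi> = (\<integral>\<^sup>+ (x, y). ennreal (norm (x - y)) \<partial>\<pi>)"

definition optimal_plan ::
    "('a::euclidean_space \<times> 'a) measure \<Rightarrow> 'a measure \<Rightarrow> 'a measure \<Rightarrow> bool" where
  "optimal_plan \<pi> \<mu> \<nu> \<longleftrightarrow> coupling \<pi> \<mu> \<nu> \<and> (\<forall>\<pi>'. coupling \<pi>' \<mu> \<nu> \<longrightarrow> W1_cost \<pi> \<le> W1_cost \<pi>')"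

definition msupport :: "'a::topological_space measure \<Rightarrow> 'a set" where
  "msupport M = {x. \<forall>U. open U \<longrightarrow> x \<in> U \<longrightarrow> emeasure M U > 0}"

text \<open>The infimum is the best Lipschitz constant only for Lipschitz \<open>u\<close>; for other functions
  the set is empty and the value is unspecified.\<close>

definition Lip :: "('a::euclidean_space \<Rightarrow> real) \<Rightarrow> real" where
  "Lip u = Inf {L. L > 0 \<and> (\<forall>x y. \<bar>u x - u y\<bar> \<le> L * norm (x - y))}"

definition stretch_set :: "('a::euclidean_space \<Rightarrow> real) \<Rightarrow> ('a \<times> 'a) set" where
  "stretch_set u = {(x, y). \<bar>u x - u y\<bar> = Lip u * norm (x - y)}"

text \<open>A constant \<open>f\<close> satisfies this for every plan, since then \<open>Lip f = 0\<close> and the stretch set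
  is the whole product space.\<close>

definition kantorovich_potential ::
    "('a::euclidean_space \<times> 'a) measure \<Rightarrow> ('a \<Rightarrow> real) \<Rightarrow> bool" where
  "kantorovich_potential \<pi> f \<longleftrightarrow> 1-lipschitz_on UNIV f \<and> emeasure \<pi> (stretch_set f) = 1"

text \<open>\<open>k\<close>-rectifiability for \<open>k = CARD('k)\<close>, the dimension being passed as a type
  (for \<open>'k = 'n option\<close> it is \<open>CARD('n) + 1\<close>). The covering is
  exact: no null set is discarded. The restriction \<open>k < d\<close>, with \<open>d = DIM('d)\<close>, is not built in;
  for \<open>k \<ge> d\<close> every set qualifies.\<close>

definition rectifiable :: "'k::finite itself \<Rightarrow> 'd::euclidean_space set \<Rightarrow> bool" where
  "rectifiable (_ :: 'k itself) E \<longleftrightarrow>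
     (\<exists>\<psi> :: nat \<Rightarrow> real ^ 'k \<Rightarrow> 'd. (\<forall>i. \<exists>L. L-lipschitz_on UNIV (\<psi> i)) \<and> E \<subseteq> (\<Union>i. range (\<psi> i)))"

text \<open>The term \<open>(diam U)\<^sup>s\<close> of the Hausdorff measure, with the conventions that the empty set
  contributes \<open>0\<close> and that \<open>0\<^sup>0 = 1\<close> for nonempty \<open>U\<close> (whereas \<open>0 powr 0 = 0\<close>).\<close>

definition hausdorff_weight :: "real \<Rightarrow> 'a::metric_space set \<Rightarrow> ennreal" where
  "hausdorff_weight s U =
     (if U = {} then 0 else if s = 0 then 1 else ennreal (diameter U powr s))"

text \<open>Boundedness is required separately because \<^const>\<open>diameter\<close> is not meaningful on
  unbounded sets. The measure carries no normalising factor, which does not affect dimensions.\<close>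

definition hausdorff_premeasure :: "real \<Rightarrow> real \<Rightarrow> 'a::metric_space set \<Rightarrow> ennreal" where
  "hausdorff_premeasure \<delta> s E =
     Inf {(\<Sum>i. hausdorff_weight s (U i)) | U :: nat \<Rightarrow> 'a set.
            E \<subseteq> (\<Union>i. U i) \<and> (\<forall>i. bounded (U i) \<and> diameter (U i) \<le> \<delta>)}"

definition hausdorff_measure :: "real \<Rightarrow> 'a::metric_space set \<Rightarrow> ennreal" where
  "hausdorff_measure s E = (SUP \<delta>\<in>{0<..}. hausdorff_premeasure \<delta> s E)"

definition hausdorff_dim :: "'a::metric_space set \<Rightarrow> ennreal" where
  "hausdorff_dim E = Inf {ennreal s | s. s \<ge> 0 \<and> hausdorff_measure s E = 0}"

end

theory Submission
  imports Defs
begin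

text \<open>
  The geometric heart is that the pairs fully stretched by a 1-Lipschitz function form an
  \<open>(n + 1)\<close>-dimensional set. If \<open>f x - f y = norm (x - y)\<close> with \<open>x \<noteq> y\<close>, then \<open>f\<close> grows with unit
  speed along the whole segment from \<open>y\<close> to \<open>x\<close>. Two such segments of length at least \<open>2\<delta>\<close>, with
  midpoints \<open>z\<close>, \<open>z'\<close> and unit directions \<open>e\<close>, \<open>e'\<close>, satisfy
  \<open>\<delta> * norm (e - e') \<le> norm (z - z')\<close>: this is the parallelogram identity applied to the two
  cross inequalities that the Lipschitz bound gives between opposite ends of the segments
  (\<open>ray_direction_Lipschitz\<close>). So on pairs with \<open>2\<delta> \<le> norm (x - y) \<le> 2T\<close> the direction is a
  Lipschitz function of the midpoint, and the pair is a Lipschitz function of midpoint and half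
  length, which are \<open>n + 1\<close> real parameters. This map is defined on an unknown subset of
  the parameter space only; McShane's extension theorem, applied to each coordinate, makes it global.
  Countably many choices of \<open>\<delta>\<close> and \<open>T\<close>, the two signs of \<open>f x - f y\<close>, and the diagonal
  exhaust the set (\<open>rectifiable_rays\<close>). For a nonconstant Lipschitz \<open>f\<close> this applies to
  \<open>f / Lip f\<close>, whose fully stretched pairs are the stretch set of \<open>f\<close>.

  That the support of the plan lies in the stretch set of a potential holds because the stretch
  set is closed and has full measure. The first claim asserts more, since the potential handed over
  might be a constant, whose stretch set is everything. So a potential with
  \<open>f x - f y = norm (x - y)\<close> on the whole support is constructed. The support of an
  optimal plan is cyclically monotone (\<open>optimal_plan_cyclically_monotone\<close>): if a permutation of
  finitely many targets lowered the total distance, then exchanging a little mass between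
  small neighbourhoods of the points involved would give a cheaper plan with the same marginals.
  Cyclical monotonicity says that a certain weighted graph on the space has no negative cycle, and
  the shortest-path distance from the origin in it is the potential
  (\<open>cyclically_monotone_potential\<close>).

  The dimension bound holds for every rectifiable set, by covering cubes with fine grids
  (\<open>hausdorff_dim_rectifiable\<close>).
\<close>

section \<open>Lipschitz extension and rectifiable sets\<close>

text \<open>The infimal convolution of \<open>g\<close> with the cone \<open>C * dist x a\<close> is the largest
  \<open>C\<close>-Lipschitz function that does not exceed \<open>g\<close> on \<open>A\<close>.\<close>

lemma McShane_extension:
  fixes g :: "'a::metric_space \<Rightarrow> real"
  assumes g: "C-lipschitz_on A g"
  obtains h where "C-lipschitz_on UNIV h" "\<And>x. x \<in> A \<Longrightarrow> h x = g x"
proof (cases "A = {}")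
  case True
  have "C-lipschitz_on UNIV (\<lambda>_::'a. 0::real)"
    using lipschitz_on_nonneg[OF g] by (auto simp: lipschitz_on_def)
  then show ?thesis using True by (intro that) auto
next
  case False
  have C: "0 \<le> C" using lipschitz_on_nonneg[OF g] .
  define h where "h x = (INF a\<in>A. g a + C * dist x a)" for x
  have lower: "g a - C * dist x a \<le> g b + C * dist x b" if "a \<in> A" "b \<in> A" for a b x
  proof -
    have "g a - g b \<le> C * dist a b"
      using lipschitz_onD[OF g that] by (auto simp: dist_real_def)
    also have "\<dots> \<le> C * (dist x a + dist x b)"
      using C by (intro mult_left_mono dist_triangle3)
    finally show ?thesis by (simp add: algebra_simps)
  qed
  obtain a0 where "a0 \<in> A" using False by blast
  then have bdd: "bdd_below ((\<lambda>a. g a + C * dist x a) ` A)" for x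
    using lower[of a0] by (intro bdd_belowI2)
  have step: "h x \<le> h y + C * dist x y" for x y
  proof -
    have "h x - C * dist x y \<le> g a + C * dist y a" if "a \<in> A" for a
    proof -
      have "h x \<le> g a + C * dist x a"
        unfolding h_def by (rule cINF_lower[OF bdd that])
      also have "\<dots> \<le> g a + C * (dist x y + dist y a)"
        using C by (intro add_left_mono mult_left_mono dist_triangle)
      finally show ?thesis by (simp add: algebra_simps)
    qed
    then have "h x - C * dist x y \<le> h y"
      unfolding h_def[of y] using False by (intro cINF_greatest) auto
    then show ?thesis by simp
  qed
  show ?thesis
  proof (rule that)
    show "C-lipschitz_on UNIV h"
    proof (rule lipschitz_onI)
      fix x y
      show "dist (h x) (h y) \<le> C * dist x y"
        using step[of x y] step[of y x] by (simp add: dist_real_def dist_commute)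
    qed (rule C)
  next
    fix x assume x: "x \<in> A"
    have "g x \<le> h x"
      unfolding h_def using False lower[OF x, of _ x] by (intro cINF_greatest) auto
    moreover have "h x \<le> g x"
      unfolding h_def using cINF_lower[OF bdd x, of x] by simp
    ultimately show "h x = g x" by simp
  qed
qed

text \<open>Extending coordinate by coordinate loses a dimensional factor in
  the constant, which rectifiability does not see.\<close>

lemma McShane_extension_euclidean:
  fixes g :: "'a::metric_space \<Rightarrow> 'b::euclidean_space"
  assumes g: "C-lipschitz_on A g"
  obtains h D where "D-lipschitz_on UNIV h" "\<And>x. x \<in> A \<Longrightarrow> h x = g x"
proof -
  have comp: "C-lipschitz_on A (\<lambda>x. g x \<bullet> b)" if "b \<in> Basis" for b
  proof (rule lipschitz_onI)
    fix x y assume "x \<in> A" "y \<in> A"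
    then have "norm (g x - g y) \<le> C * dist x y"
      using lipschitz_onD[OF g] by (simp add: dist_norm)
    then show "dist (g x \<bullet> b) (g y \<bullet> b) \<le> C * dist x y"
      using Basis_le_norm[OF that, of "g x - g y"]
      by (simp add: dist_real_def inner_diff_left)
  qed (rule lipschitz_on_nonneg[OF g])
  have "\<exists>h. C-lipschitz_on UNIV h \<and> (\<forall>x\<in>A. h x = g x \<bullet> b)" if b: "b \<in> Basis" for b
  proof -
    obtain h where "C-lipschitz_on UNIV h" "\<And>x. x \<in> A \<Longrightarrow> h x = g x \<bullet> b"
      by (rule McShane_extension[OF comp[OF b]]) blast
    then show ?thesis by blast
  qed
  then have "\<forall>b\<in>Basis. \<exists>h. C-lipschitz_on UNIV h \<and> (\<forall>x\<in>A. h x = g x \<bullet> b)" by simp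
  from bchoice[OF this] obtain h where h: "\<And>b. b \<in> Basis \<Longrightarrow> C-lipschitz_on UNIV (h b)"
    "\<And>b x. b \<in> Basis \<Longrightarrow> x \<in> A \<Longrightarrow> h b x = g x \<bullet> b"
    by blast
  show ?thesis
  proof (rule that)
    show "(DIM('b) * C)-lipschitz_on UNIV (\<lambda>x. \<Sum>b\<in>Basis. h b x *\<^sub>R b)"
    proof (rule lipschitz_onI)
      fix x y
      have "dist (\<Sum>b\<in>Basis. h b x *\<^sub>R b) (\<Sum>b\<in>Basis. h b y *\<^sub>R b)
          = norm (\<Sum>b\<in>(Basis::'b set). (h b x - h b y) *\<^sub>R b)"
        by (simp add: dist_norm sum_subtractf scaleR_diff_left)
      also have "\<dots> \<le> (\<Sum>b\<in>(Basis::'b set). C * dist x y)"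
      proof (rule order_trans[OF norm_sum], rule sum_mono)
        fix b :: 'b assume "b \<in> Basis"
        then show "norm ((h b x - h b y) *\<^sub>R b) \<le> C * dist x y"
          using lipschitz_onD[OF h(1), of b x y] by (simp add: dist_real_def)
      qed
      finally show "dist (\<Sum>b\<in>Basis. h b x *\<^sub>R b) (\<Sum>b\<in>Basis. h b y *\<^sub>R b)
          \<le> DIM('b) * C * dist x y"
        by simp
    qed (use lipschitz_on_nonneg[OF g] in simp)
  qed (simp add: h(2) euclidean_representation)
qed

lemma rectifiable_subset:
  "rectifiable TYPE('k::finite) F \<Longrightarrow> E \<subseteq> F \<Longrightarrow> rectifiable TYPE('k) E"
  unfolding rectifiable_def by blast

lemma rectifiable_UN:
  fixes E :: "nat \<Rightarrow> 'd::euclidean_space set"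
  assumes "\<And>i. rectifiable TYPE('k::finite) (E i)"
  shows "rectifiable TYPE('k) (\<Union>i. E i)"
proof -
  have "\<forall>i. \<exists>\<psi>::nat \<Rightarrow> real ^ 'k \<Rightarrow> 'd.
      (\<forall>j. \<exists>L. L-lipschitz_on UNIV (\<psi> j)) \<and> E i \<subseteq> (\<Union>j. range (\<psi> j))"
    using assms unfolding rectifiable_def by simp
  from choice[OF this] obtain \<psi> :: "nat \<Rightarrow> nat \<Rightarrow> real ^ 'k \<Rightarrow> 'd" where
    \<psi>: "\<And>i j. \<exists>L. L-lipschitz_on UNIV (\<psi> i j)" "\<And>i. E i \<subseteq> (\<Union>j. range (\<psi> i j))"
    by blast
  show ?thesis
    unfolding rectifiable_def
  proof (intro exI[of _ "\<lambda>m. \<psi> (fst (prod_decode m)) (snd (prod_decode m))"] conjI allI)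
    show "(\<Union>i. E i) \<subseteq> (\<Union>m. range (\<psi> (fst (prod_decode m)) (snd (prod_decode m))))"
    proof
      fix x assume "x \<in> (\<Union>i. E i)"
      then obtain i j where "x \<in> range (\<psi> i j)" using \<psi>(2) by blast
      then show "x \<in> (\<Union>m. range (\<psi> (fst (prod_decode m)) (snd (prod_decode m))))"
        by (intro UN_I[of "prod_encode (i, j)"]) auto
    qed
  qed (rule \<psi>(1))
qed

lemma rectifiable_Un:
  fixes E :: "'d::euclidean_space set"
  assumes "rectifiable TYPE('k::finite) E" "rectifiable TYPE('k) F"
  shows "rectifiable TYPE('k) (E \<union> F)"
proof -
  have "rectifiable TYPE('k) (\<Union>i::nat. if i = 0 then E else F)"
    using assms by (intro rectifiable_UN) auto
  then show ?thesis by (rule rectifiable_subset) (auto split: if_splits)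
qed

text \<open>A chart that contracts distances by at most a fixed factor
  has a Lipschitz inverse on its image, and an extension of this inverse parametrizes \<open>E\<close>. Charts
  are easier to write down than parametrizations, since no description of their image is required.\<close>

lemma rectifiable_if_expanding_chart:
  fixes \<phi> :: "'d::euclidean_space \<Rightarrow> real ^ 'k::finite"
  assumes C: "0 \<le> C"
    and \<phi>: "\<And>p q. p \<in> E \<Longrightarrow> q \<in> E \<Longrightarrow> dist p q \<le> C * dist (\<phi> p) (\<phi> q)"
  shows "rectifiable TYPE('k) E"
proof -
  have "inj_on \<phi> E"
  proof (rule inj_onI)
    fix p q assume "p \<in> E" "q \<in> E" "\<phi> p = \<phi> q"
    then show "p = q" using \<phi>[of p q] by simp
  qed
  then have inv: "inv_into E \<phi> (\<phi> p) = p" if "p \<in> E" for p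
    using that by simp
  have "C-lipschitz_on (\<phi> ` E) (inv_into E \<phi>)"
    using C by (intro lipschitz_onI) (auto simp: inv \<phi>)
  then obtain h D where h: "D-lipschitz_on UNIV h" "\<And>x. x \<in> \<phi> ` E \<Longrightarrow> h x = inv_into E \<phi> x"
    by (rule McShane_extension_euclidean) blast
  have "p \<in> range h" if "p \<in> E" for p
    using h(2)[of "\<phi> p"] inv[OF that] that by (intro range_eqI[of _ _ "\<phi> p"]) auto
  then have "(\<forall>i::nat. \<exists>L. L-lipschitz_on UNIV h) \<and> E \<subseteq> (\<Union>i::nat. range h)"
    using h(1) by auto
  then show ?thesis
    unfolding rectifiable_def by (rule exI[of _ "\<lambda>_. h"])
qed

section \<open>Transport rays of a 1-Lipschitz function\<close>

text \<open>Transport rays cannot cross in their interior; quantitatively, directions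
  vary in a Lipschitz way with the midpoint. The Lipschitz bound between the upper end of each ray and
  the lower end of the other adds up to
  \<open>4\<delta> \<le> norm (w + v) + norm (w - v)\<close> for \<open>w = z - z'\<close> and \<open>v = \<delta> (e + e')\<close>. The parallelogram
  identity bounds the right-hand side by the lengths of \<open>w\<close> and \<open>v\<close>, and, applied once more,
  turns the length of \<open>e + e'\<close> into that of \<open>e - e'\<close>.\<close>

lemma ray_direction_Lipschitz:
  fixes f :: "'a::euclidean_space \<Rightarrow> real"
  assumes f: "1-lipschitz_on UNIV f" and e: "norm e = 1" "norm e' = 1" and \<delta>: "0 < \<delta>"
    and ray: "2 * \<delta> \<le> f (z + \<delta> *\<^sub>R e) - f (z - \<delta> *\<^sub>R e)"
    and ray': "2 * \<delta> \<le> f (z' + \<delta> *\<^sub>R e') - f (z' - \<delta> *\<^sub>R e')"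
  shows "\<delta> * norm (e - e') \<le> norm (z - z')"
proof -
  define w v where "w = z - z'" and "v = \<delta> *\<^sub>R (e + e')"
  have lip: "f x - f y \<le> norm (x - y)" for x y
    using lipschitz_onD[OF f, of x y] by (auto simp: dist_norm)
  have *: "4 * \<delta> \<le> norm (w + v) + norm (w - v)"
  proof -
    have "f (z + \<delta> *\<^sub>R e) - f (z' - \<delta> *\<^sub>R e') \<le> norm (w + v)"
      using lip[of "z + \<delta> *\<^sub>R e" "z' - \<delta> *\<^sub>R e'"] by (simp add: w_def v_def algebra_simps)
    moreover have "f (z' + \<delta> *\<^sub>R e') - f (z - \<delta> *\<^sub>R e) \<le> norm (w - v)"
      using lip[of "z' + \<delta> *\<^sub>R e'" "z - \<delta> *\<^sub>R e"] norm_minus_commute[of w v]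
      by (simp add: w_def v_def algebra_simps)
    ultimately show ?thesis using ray ray' by linarith
  qed
  have parallelogram: "(norm (a + b))\<^sup>2 + (norm (a - b))\<^sup>2 = 2 * (norm a)\<^sup>2 + 2 * (norm b)\<^sup>2"
    for a b :: 'a
    by (simp add: power2_norm_eq_inner inner_add inner_diff algebra_simps inner_commute)
  have "(4 * \<delta>)\<^sup>2 \<le> (norm (w + v) + norm (w - v))\<^sup>2"
    using * \<delta> by (intro power_mono) auto
  also have "\<dots> \<le> 2 * ((norm (w + v))\<^sup>2 + (norm (w - v))\<^sup>2)"
    using sum_squares_bound[of "norm (w + v)" "norm (w - v)"]
    by (simp add: power2_sum)
  also have "\<dots> = 4 * (norm w)\<^sup>2 + 4 * (norm v)\<^sup>2"
    by (simp add: parallelogram)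
  also have "(norm v)\<^sup>2 = \<delta>\<^sup>2 * (4 - (norm (e - e'))\<^sup>2)"
    using parallelogram[of e e'] e by (simp add: v_def power_mult_distrib)
  finally have "(\<delta> * norm (e - e'))\<^sup>2 \<le> (norm w)\<^sup>2"
    by (simp add: power_mult_distrib algebra_simps)
  then show ?thesis
    unfolding w_def by (rule power2_le_imp_le) simp
qed

text \<open>Half length and midpoint of a pair, as one vector: the extra index \<open>None\<close> of the
  option type carries the half length.\<close>

definition ray_chart :: "(real ^ 'n) \<times> (real ^ 'n) \<Rightarrow> real ^ 'n option" where
  "ray_chart p = (\<chi> i. case i of
     None \<Rightarrow> norm (fst p - snd p) / 2
   | Some j \<Rightarrow> ((1/2) *\<^sub>R (fst p + snd p)) $ j)"

lemma ray_chart_half_length: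
  "\<bar>norm (fst p - snd p) / 2 - norm (fst q - snd q) / 2\<bar> \<le> dist (ray_chart p) (ray_chart q)"
  using dist_vec_nth_le[of "ray_chart p" None "ray_chart q"]
  by (simp add: ray_chart_def dist_real_def)

lemma ray_chart_midpoint:
  fixes p q :: "(real ^ 'n) \<times> (real ^ 'n)"
  shows "norm ((1/2) *\<^sub>R (fst p + snd p) - (1/2) *\<^sub>R (fst q + snd q))
    \<le> CARD('n) * dist (ray_chart p) (ray_chart q)"
proof -
  let ?z = "\<lambda>p::(real ^ 'n) \<times> (real ^ 'n). (1/2) *\<^sub>R (fst p + snd p)"
  have "norm (?z p - ?z q) \<le> (\<Sum>j\<in>UNIV. \<bar>(?z p - ?z q) $ j\<bar>)"
    by (rule norm_le_l1_cart)
  also have "\<dots> \<le> (\<Sum>j\<in>(UNIV::'n set). dist (ray_chart p) (ray_chart q))"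
  proof (rule sum_mono)
    fix j :: 'n
    show "\<bar>(?z p - ?z q) $ j\<bar> \<le> dist (ray_chart p) (ray_chart q)"
      using dist_vec_nth_le[of "ray_chart p" "Some j" "ray_chart q"]
      by (simp add: ray_chart_def dist_real_def)
  qed
  finally show ?thesis by simp
qed

text \<open>The map from a pair to midpoint and difference is
  a linear isomorphism; this is the bound for its inverse.\<close>

lemma dist_le_midpoint_half_difference:
  fixes p q :: "'a::euclidean_space \<times> 'a"
  shows "dist p q \<le> 2 * norm ((1/2) *\<^sub>R (fst p + snd p) - (1/2) *\<^sub>R (fst q + snd q))
    + norm ((fst p - snd p) - (fst q - snd q))"
proof -
  let ?w = "(1/2) *\<^sub>R (fst p + snd p) - (1/2) *\<^sub>R (fst q + snd q)"
  let ?h = "(1/2) *\<^sub>R ((fst p - snd p) - (fst q - snd q))"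
  have "fst p - fst q = ?w + ?h" "snd p - snd q = ?w - ?h"
    by (simp_all add: algebra_simps flip: scaleR_add_left)
  then have "norm (fst p - fst q) \<le> norm ?w + norm ?h" "norm (snd p - snd q) \<le> norm ?w + norm ?h"
    using norm_triangle_ineq[of ?w ?h] norm_triangle_ineq4[of ?w ?h] by auto
  moreover have "dist p q \<le> norm (fst p - fst q) + norm (snd p - snd q)"
    using norm_Pair_le[of "fst p - fst q" "snd p - snd q"]
    by (simp add: dist_norm flip: minus_prod_def)
  moreover have "norm ?h = norm ((fst p - snd p) - (fst q - snd q)) / 2"
    by (simp only: norm_scaleR)
  ultimately show ?thesis by linarith
qed

text \<open>The lower bound on the length makes the direction of a ray Lipschitz in its
  midpoint, and the upper bound keeps an error in the direction from being amplified along the ray.\<close>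

lemma rectifiable_ray_piece:
  fixes f :: "real ^ 'n \<Rightarrow> real"
  assumes f: "1-lipschitz_on UNIV f" and \<delta>: "0 < \<delta>" and T: "0 \<le> T"
  shows "rectifiable TYPE('n option)
    {(x, y). f x - f y = norm (x - y) \<and> 2 * \<delta> \<le> norm (x - y) \<and> norm (x - y) \<le> 2 * T}"
    (is "rectifiable _ ?E")
proof (rule rectifiable_if_expanding_chart)
  \<comment> \<open>The chart controls the half length with factor \<open>1\<close>, the midpoint with factor
    \<open>CARD('n)\<close>, and the direction, scaled by a half length of at most \<open>T\<close>, with factor
    \<open>CARD('n) * T / \<delta>\<close>.\<close>
  define C where "C = 2 + 2 * CARD('n) * (1 + T / \<delta>)"
  show "0 \<le> C" using \<delta> T by (simp add: C_def)
  have lip: "f x - f y \<le> norm (x - y)" for x y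
    using lipschitz_onD[OF f, of x y] by (auto simp: dist_norm)
  define t e z where "t p = norm (fst p - snd p) / 2"
    and "e p = (1 / norm (fst p - snd p)) *\<^sub>R (fst p - snd p)"
    and "z p = (1/2) *\<^sub>R (fst p + snd p)" for p :: "(real ^ 'n) \<times> (real ^ 'n)"
  have piece: "\<delta> \<le> t p" "t p \<le> T" "f (fst p) - f (snd p) = 2 * t p" "norm (e p) = 1"
    "fst p - snd p = (2 * t p) *\<^sub>R e p" "2 * \<delta> \<le> f (z p + \<delta> *\<^sub>R e p) - f (z p - \<delta> *\<^sub>R e p)"
    if "p \<in> ?E" for p
  proof -
    show t: "\<delta> \<le> t p" "t p \<le> T" and ft: "f (fst p) - f (snd p) = 2 * t p"
      using that by (auto simp: t_def)
    have ne: "fst p \<noteq> snd p" using t(1) \<delta> by (auto simp: t_def)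
    show e1: "norm (e p) = 1" and d: "fst p - snd p = (2 * t p) *\<^sub>R e p"
      using ne by (auto simp: e_def t_def)
    have x: "fst p = z p + t p *\<^sub>R e p"
    proof -
      have "z p + t p *\<^sub>R e p = z p + (1/2) *\<^sub>R (fst p - snd p)" by (subst d) simp
      then show ?thesis by (simp add: z_def algebra_simps flip: scaleR_add_left)
    qed
    have y: "snd p = z p - t p *\<^sub>R e p"
    proof -
      have "z p - t p *\<^sub>R e p = z p - (1/2) *\<^sub>R (fst p - snd p)" by (subst d) simp
      then show ?thesis by (simp add: z_def algebra_simps flip: scaleR_add_left)
    qed
    \<comment> \<open>Shortening a ray at both ends to half length \<open>\<delta>\<close> keeps it fully stretched, since
      \<open>f\<close> cannot lose more than the length cut off.\<close>
    have "fst p - (z p + \<delta> *\<^sub>R e p) = (t p - \<delta>) *\<^sub>R e p"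
      by (subst x) (simp add: algebra_simps)
    then have "f (fst p) - f (z p + \<delta> *\<^sub>R e p) \<le> t p - \<delta>"
      using lip[of "fst p" "z p + \<delta> *\<^sub>R e p"] t e1 by simp
    moreover have "(z p - \<delta> *\<^sub>R e p) - snd p = (t p - \<delta>) *\<^sub>R e p"
      by (subst y) (simp add: algebra_simps)
    then have "f (z p - \<delta> *\<^sub>R e p) - f (snd p) \<le> t p - \<delta>"
      using lip[of "z p - \<delta> *\<^sub>R e p" "snd p"] t e1 by simp
    ultimately show "2 * \<delta> \<le> f (z p + \<delta> *\<^sub>R e p) - f (z p - \<delta> *\<^sub>R e p)"
      using ft by linarith
  qed
  fix p q assume p: "p \<in> ?E" and q: "q \<in> ?E"
  define D where "D = dist (ray_chart p) (ray_chart q)"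
  have zD: "norm (z p - z q) \<le> CARD('n) * D"
    unfolding z_def D_def by (rule ray_chart_midpoint)
  have tD: "\<bar>t p - t q\<bar> \<le> D"
    unfolding t_def D_def by (rule ray_chart_half_length)
  have "\<delta> * norm (e p - e q) \<le> norm (z p - z q)"
    using piece(4,6)[OF p] piece(4,6)[OF q] by (intro ray_direction_Lipschitz[OF f _ _ \<delta>])
  then have eD: "norm (e p - e q) \<le> CARD('n) * D / \<delta>"
    using zD \<delta> by (simp add: field_simps)
  \<comment> \<open>Differences are split into a change of length and a change of direction.\<close>
  have "(fst p - snd p) - (fst q - snd q) = (2 * (t p - t q)) *\<^sub>R e p + (2 * t q) *\<^sub>R (e p - e q)"
    unfolding piece(5)[OF p] piece(5)[OF q] by (simp add: algebra_simps)
  then have "norm ((fst p - snd p) - (fst q - snd q))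
      \<le> norm ((2 * (t p - t q)) *\<^sub>R e p) + norm ((2 * t q) *\<^sub>R (e p - e q))"
    by (metis norm_triangle_ineq)
  also have "\<dots> = 2 * \<bar>t p - t q\<bar> + 2 * t q * norm (e p - e q)"
    using piece(4)[OF p] piece(1)[OF q] \<delta> by (simp add: abs_mult del: right_diff_distrib_numeral)
  also have "\<dots> \<le> 2 * D + 2 * T * (CARD('n) * D / \<delta>)"
    using tD eD piece(1,2)[OF q] \<delta> by (intro add_mono mult_mono) auto
  finally have "dist p q \<le> 2 * (CARD('n) * D) + (2 * D + 2 * T * (CARD('n) * D / \<delta>))"
    using dist_le_midpoint_half_difference[of p q] zD unfolding z_def[symmetric] by linarith
  also have "\<dots> = C * D" by (simp add: C_def algebra_simps)
  finally show "dist p q \<le> C * dist (ray_chart p) (ray_chart q)" unfolding D_def .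
qed

lemma rectifiable_diagonal:
  "rectifiable TYPE('n option) {(x, y). x = (y :: real ^ 'n)}"
proof (rule rectifiable_if_expanding_chart)
  fix p q :: "(real ^ 'n) \<times> (real ^ 'n)"
  assume "p \<in> {(x, y). x = y}" "q \<in> {(x, y). x = y}"
  then have "dist p q \<le> 2 * norm ((1/2) *\<^sub>R (fst p + snd p) - (1/2) *\<^sub>R (fst q + snd q))"
    using dist_le_midpoint_half_difference[of p q] by auto
  then show "dist p q \<le> (2 * CARD('n)) * dist (ray_chart p) (ray_chart q)"
    using ray_chart_midpoint[of p q] by linarith
qed simp

lemma rectifiable_oriented_rays:
  fixes f :: "real ^ 'n \<Rightarrow> real"
  assumes f: "1-lipschitz_on UNIV f"
  shows "rectifiable TYPE('n option) {(x, y). f x - f y = norm (x - y)}"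
proof (rule rectifiable_subset)
  let ?E = "\<lambda>i::nat. {(x, y). f x - f y = norm (x - y) \<and>
    2 * (1 / real (Suc i)) \<le> norm (x - y) \<and> norm (x - y) \<le> 2 * real (Suc i)}"
  show "rectifiable TYPE('n option) ({(x, y). x = y} \<union> (\<Union>i. ?E i))"
    by (rule rectifiable_Un[OF rectifiable_diagonal rectifiable_UN])
      (rule rectifiable_ray_piece[OF f], simp_all)
  have "\<exists>i::nat. 2 * (1 / real (Suc i)) \<le> norm (x - y) \<and> norm (x - y) \<le> 2 * real (Suc i)"
    if "x \<noteq> y" for x y :: "real ^ 'n"
  proof -
    define r where "r = norm (x - y)"
    have r: "0 < r" using that by (simp add: r_def)
    obtain i :: nat where i: "max r (2 / r) \<le> i" using real_arch_simple by blast
    have "2 \<le> r * i" using i r by (simp add: field_simps)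
    also have "\<dots> \<le> r * (1 + real i)" using r by simp
    finally have "2 * (1 / real (Suc i)) \<le> r" by (simp add: field_simps)
    moreover have "r \<le> 2 * real (Suc i)" using i by auto
    ultimately show ?thesis unfolding r_def by blast
  qed
  then show "{(x, y). f x - f y = norm (x - y)} \<subseteq> {(x, y). x = y} \<union> (\<Union>i. ?E i)"
    by blast
qed

text \<open>Reversing a ray amounts to replacing \<open>f\<close> by \<open>- f\<close>.\<close>

lemma rectifiable_rays:
  fixes f :: "real ^ 'n \<Rightarrow> real"
  assumes f: "1-lipschitz_on UNIV f"
  shows "rectifiable TYPE('n option) {(x, y). \<bar>f x - f y\<bar> = norm (x - y)}"
proof -
  have "1-lipschitz_on UNIV (\<lambda>x. - f x)" using f by simp
  then have "rectifiable TYPE('n option) {(x, y). - f x - - f y = norm (x - y)}"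
    by (rule rectifiable_oriented_rays)
  with rectifiable_oriented_rays[OF f]
  have "rectifiable TYPE('n option)
      ({(x, y). f x - f y = norm (x - y)} \<union> {(x, y). - f x - - f y = norm (x - y)})"
    by (rule rectifiable_Un)
  moreover have "f x - f y = norm (x - y) \<or> - f x - - f y = norm (x - y)"
    if "\<bar>f x - f y\<bar> = norm (x - y)" for x y
    using that by linarith
  then have "{(x, y). \<bar>f x - f y\<bar> = norm (x - y)} \<subseteq>
      {(x, y). f x - f y = norm (x - y)} \<union> {(x, y). - f x - - f y = norm (x - y)}"
    by blast
  ultimately show ?thesis by (rule rectifiable_subset)
qed

section \<open>Hausdorff dimension of rectifiable sets\<close>

text \<open>Vanishing of the Hausdorff measure expressed through individual covers: in this form
  the usual argument with errors \<open>\<epsilon> / 2 ^ i\<close> gives stability under countable unions.\<close>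

definition hausdorff_null :: "real \<Rightarrow> 'a::metric_space set \<Rightarrow> bool" where
  "hausdorff_null s E \<longleftrightarrow> (\<forall>\<delta>>0. \<forall>\<epsilon>>0. \<exists>U :: nat \<Rightarrow> 'a set.
     E \<subseteq> (\<Union>i. U i) \<and> (\<forall>i. bounded (U i) \<and> diameter (U i) \<le> \<delta>) \<and>
     (\<Sum>i. hausdorff_weight s (U i)) \<le> ennreal \<epsilon>)"

lemma hausdorff_null_subset:
  "hausdorff_null s F \<Longrightarrow> E \<subseteq> F \<Longrightarrow> hausdorff_null s E"
  unfolding hausdorff_null_def by (meson subset_trans)

lemma hausdorff_measure_null:
  assumes "hausdorff_null s E"
  shows "hausdorff_measure s E = 0"
proof -
  have "hausdorff_premeasure \<delta> s E = 0" if \<delta>: "0 < \<delta>" for \<delta>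
  proof -
    have "hausdorff_premeasure \<delta> s E \<le> 0 + ennreal \<epsilon>" if \<epsilon>: "0 < \<epsilon>" for \<epsilon>
    proof -
      obtain U :: "nat \<Rightarrow> 'a set" where U: "E \<subseteq> (\<Union>i. U i)"
        "\<forall>i. bounded (U i) \<and> diameter (U i) \<le> \<delta>"
        "(\<Sum>i. hausdorff_weight s (U i)) \<le> ennreal \<epsilon>"
        using assms \<delta> \<epsilon> unfolding hausdorff_null_def by blast
      have "hausdorff_premeasure \<delta> s E \<le> (\<Sum>i. hausdorff_weight s (U i))"
        unfolding hausdorff_premeasure_def by (rule Inf_lower) (use U(1,2) in blast)
      with U(3) show ?thesis by simp
    qed
    then have "hausdorff_premeasure \<delta> s E \<le> 0" by (rule ennreal_le_epsilon)
    then show ?thesis by simp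
  qed
  then show ?thesis unfolding hausdorff_measure_def
    by (simp add: SUP_eq_iff bot_ennreal)
qed

lemma hausdorff_null_UN:
  fixes E :: "nat \<Rightarrow> 'a::metric_space set"
  assumes E: "\<And>i. hausdorff_null s (E i)"
  shows "hausdorff_null s (\<Union>i. E i)"
  unfolding hausdorff_null_def
proof (intro allI impI)
  fix \<delta> \<epsilon> :: real assume \<delta>: "0 < \<delta>" and \<epsilon>: "0 < \<epsilon>"
  have "\<forall>i. \<exists>U :: nat \<Rightarrow> 'a set. E i \<subseteq> (\<Union>j. U j) \<and>
      (\<forall>j. bounded (U j) \<and> diameter (U j) \<le> \<delta>) \<and>
      (\<Sum>j. hausdorff_weight s (U j)) \<le> ennreal (\<epsilon> * (1/2) ^ Suc i)"
  proof
    fix i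
    have "0 < \<epsilon> * (1/2) ^ Suc i" using \<epsilon> by simp
    with E[of i] \<delta> show "\<exists>U :: nat \<Rightarrow> 'a set. E i \<subseteq> (\<Union>j. U j) \<and>
      (\<forall>j. bounded (U j) \<and> diameter (U j) \<le> \<delta>) \<and>
      (\<Sum>j. hausdorff_weight s (U j)) \<le> ennreal (\<epsilon> * (1/2) ^ Suc i)"
      unfolding hausdorff_null_def by blast
  qed
  from choice[OF this] obtain U :: "nat \<Rightarrow> nat \<Rightarrow> 'a set" where
    U: "\<And>i. E i \<subseteq> (\<Union>j. U i j)" "\<And>i j. bounded (U i j)" "\<And>i j. diameter (U i j) \<le> \<delta>"
    "\<And>i. (\<Sum>j. hausdorff_weight s (U i j)) \<le> ennreal (\<epsilon> * (1/2) ^ Suc i)"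
    by blast
  define V where "V m = U (fst (prod_decode m)) (snd (prod_decode m))" for m
  have "(\<Union>i. E i) \<subseteq> (\<Union>m. V m)"
  proof
    fix x assume "x \<in> (\<Union>i. E i)"
    then obtain i j where "x \<in> U i j" using U(1) by blast
    then show "x \<in> (\<Union>m. V m)"
      by (intro UN_I[of "prod_encode (i, j)"]) (auto simp: V_def)
  qed
  moreover have "\<forall>m. bounded (V m) \<and> diameter (V m) \<le> \<delta>"
    by (simp add: V_def U(2,3))
  moreover have "(\<Sum>m. hausdorff_weight s (V m)) \<le> ennreal \<epsilon>"
  proof -
    have "(\<Sum>m. hausdorff_weight s (V m)) = (\<Sum>i. \<Sum>j. hausdorff_weight s (U i j))"
      using suminf_ennreal_2dimen[of "\<lambda>i. \<Sum>j. hausdorff_weight s (U i j)"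
          "\<lambda>(i, j). hausdorff_weight s (U i j)"]
      by (simp add: V_def comp_def case_prod_unfold)
    also have "\<dots> \<le> (\<Sum>i. ennreal (\<epsilon> * (1/2) ^ Suc i))"
      using U(4) by (intro suminf_le) auto
    also have "\<dots> = ennreal \<epsilon>"
      using sums_mult[OF power_half_series, of \<epsilon>] \<epsilon>
      by (intro suminf_ennreal_eq) auto
    finally show ?thesis .
  qed
  ultimately show "\<exists>U. (\<Union>i. E i) \<subseteq> (\<Union>i. U i) \<and>
      (\<forall>i. bounded (U i) \<and> diameter (U i) \<le> \<delta>) \<and>
      (\<Sum>i. hausdorff_weight s (U i)) \<le> ennreal \<epsilon>"
    by blast
qed

text \<open>A finite cover is padded with empty sets to a sequence, and these have weight
  \<open>0\<close>.\<close>

lemma hausdorff_null_finite_cover: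
  fixes E :: "'a::euclidean_space set"
  assumes s: "0 < s"
    and fin: "\<And>\<delta> \<epsilon>::real. 0 < \<delta> \<Longrightarrow> 0 < \<epsilon> \<Longrightarrow> \<exists>F d. finite F \<and> E \<subseteq> \<Union>F \<and> 0 \<le> d \<and> d \<le> \<delta> \<and>
      (\<forall>A\<in>F. \<forall>x\<in>A. \<forall>y\<in>A. dist x y \<le> d) \<and> real (card F) * d powr s \<le> \<epsilon>"
  shows "hausdorff_null s E"
  unfolding hausdorff_null_def
proof (intro allI impI)
  fix \<delta> \<epsilon> :: real assume \<delta>: "0 < \<delta>" and \<epsilon>: "0 < \<epsilon>"
  obtain F d where F: "finite F" "E \<subseteq> \<Union>F" "0 \<le> d" "d \<le> \<delta>"
    "\<forall>A\<in>F. \<forall>x\<in>A. \<forall>y\<in>A. dist x y \<le> d" "real (card F) * d powr s \<le> \<epsilon>"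
    using fin[OF \<delta> \<epsilon>] by blast
  obtain b where b: "bij_betw b {0..<card F} F"
    using ex_bij_betw_nat_finite[OF F(1)] by blast
  define U where "U j = (if j < card F then b j else {})" for j
  have UF: "U j \<in> F \<or> U j = {}" for j
    using bij_betwE[OF b] by (auto simp: U_def)
  have bd: "bounded (U j)" for j
    using UF[of j] F(5) unfolding bounded_two_points by auto
  have di: "diameter (U j) \<le> d" for j
    using UF[of j] F(3,5) by (intro diameter_le) (auto simp: dist_norm)
  have "E \<subseteq> (\<Union>j. U j)"
  proof
    fix x assume "x \<in> E"
    then obtain A where A: "A \<in> F" "x \<in> A" using F(2) by blast
    then have "A \<in> b ` {0..<card F}" using bij_betw_imp_surj_on[OF b] by simp
    then obtain j where "j < card F" "b j = A" by auto
    with A show "x \<in> (\<Union>j. U j)" by (auto simp: U_def)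
  qed
  moreover have "\<forall>j. bounded (U j) \<and> diameter (U j) \<le> \<delta>"
    by (intro allI conjI bd order_trans[OF di F(4)])
  moreover have "(\<Sum>j. hausdorff_weight s (U j)) \<le> ennreal \<epsilon>"
  proof -
    have "(\<Sum>j. hausdorff_weight s (U j)) = (\<Sum>j<card F. hausdorff_weight s (U j))"
      by (rule suminf_finite) (auto simp: U_def hausdorff_weight_def)
    also have "\<dots> \<le> (\<Sum>j<card F. ennreal (d powr s))"
    proof (rule sum_mono)
      fix j
      show "hausdorff_weight s (U j) \<le> ennreal (d powr s)"
        using s di[of j] diameter_ge_0[OF bd, of j]
        by (auto simp: hausdorff_weight_def intro!: ennreal_leI powr_mono2)
    qed
    also have "\<dots> = ennreal (card F * d powr s)"
      by (simp add: ennreal_mult ennreal_of_nat_eq_real_of_nat)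
    also have "\<dots> \<le> ennreal \<epsilon>" using F(6) by (rule ennreal_leI)
    finally show ?thesis .
  qed
  ultimately show "\<exists>U. E \<subseteq> (\<Union>i. U i) \<and> (\<forall>i. bounded (U i) \<and> diameter (U i) \<le> \<delta>) \<and>
      (\<Sum>i. hausdorff_weight s (U i)) \<le> ennreal \<epsilon>"
    by (intro exI[of _ U] conjI)
qed

text \<open>A grid of \<open>N ^ k\<close> cells of side \<open>2 * R / N\<close> maps to sets of diameter at
  most \<open>c / N\<close>, so the \<open>s\<close>-weights add up to at most \<open>c powr s * N powr (k - s)\<close>, which tends
  to \<open>0\<close> because \<open>s > k\<close>.\<close>

lemma hausdorff_null_Lipschitz_cube:
  fixes \<psi> :: "real ^ 'k::finite \<Rightarrow> 'a::euclidean_space" and s R :: real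
  assumes \<psi>: "L-lipschitz_on UNIV \<psi>" and s: "CARD('k) < s" and R: "0 < R"
  shows "hausdorff_null s (\<psi> ` {x. \<forall>i. - R \<le> x $ i \<and> x $ i < R})"
proof (rule hausdorff_null_finite_cover)
  show "0 < s" using s of_nat_0_le_iff[of "CARD('k)", where 'a = real] by linarith
  fix \<delta> \<epsilon> :: real assume \<delta>: "0 < \<delta>" and \<epsilon>: "0 < \<epsilon>"
  have L: "0 \<le> L" using lipschitz_on_nonneg[OF \<psi>] .
  define c where "c = L * (CARD('k) * (2 * R))"
  have c: "0 \<le> c" using L R by (simp add: c_def)
  have "(\<lambda>N. c powr s * real N powr (CARD('k) - s)) \<longlonglongrightarrow> c powr s * 0"
    using s by (intro tendsto_mult tendsto_const tendsto_neg_powr filterlim_real_sequentially) auto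
  then have "\<forall>\<^sub>F N in sequentially. c powr s * real N powr (CARD('k) - s) < \<epsilon>"
    using \<epsilon> by (simp add: order_tendstoD)
  moreover have "(\<lambda>N. c / real N) \<longlonglongrightarrow> 0" by (rule lim_const_over_n)
  then have "\<forall>\<^sub>F N in sequentially. c / real N < \<delta>"
    using \<delta> by (simp add: order_tendstoD)
  ultimately have "\<forall>\<^sub>F N in sequentially. c powr s * real N powr (CARD('k) - s) < \<epsilon> \<and>
      c / real N < \<delta> \<and> 0 < N"
    using eventually_gt_at_top[of 0] by eventually_elim auto
  then obtain N :: nat where N: "c powr s * real N powr (CARD('k) - s) < \<epsilon>" "c / N < \<delta>" "0 < N"
    by (auto simp: eventually_sequentially)
  \<comment> \<open>The affine map \<open>(x $ i + R) * N / (2 * R)\<close> sends the cube to \<open>[0, N)\<close> in each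
    coordinate, and cells are the preimages of unit cubes with integer corners.\<close>
  define Q where "Q g = {x :: real ^ 'k. \<forall>i. g i \<le> (x $ i + R) * N / (2 * R) \<and>
    (x $ i + R) * N / (2 * R) \<le> real (g i) + 1}" for g :: "'k \<Rightarrow> nat"
  define G where "G = (UNIV :: 'k set) \<rightarrow>\<^sub>E {..<N}"
  have G: "finite G" "card G = N ^ CARD('k)"
    by (simp_all add: G_def finite_PiE card_funcsetE)
  let ?F = "(\<lambda>g. \<psi> ` Q g) ` G"
  have "\<psi> ` {x. \<forall>i. - R \<le> x $ i \<and> x $ i < R} \<subseteq> \<Union>?F"
  proof (intro image_subsetI)
    fix x :: "real ^ 'k" assume x: "x \<in> {x. \<forall>i. - R \<le> x $ i \<and> x $ i < R}"
    define u where "u i = (x $ i + R) * N / (2 * R)" for i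
    have u: "0 \<le> u i" "u i < N" for i
    proof -
      have "- R \<le> x $ i" "x $ i < R" using x by auto
      then have xi: "0 \<le> x $ i + R" "x $ i + R < 2 * R" by linarith+
      show "0 \<le> u i" using xi R by (simp add: u_def)
      have "(x $ i + R) * N < (2 * R) * N" using xi N(3) by (intro mult_strict_right_mono) auto
      then show "u i < N" using R by (simp add: u_def field_simps)
    qed
    define g where "g i = nat \<lfloor>u i\<rfloor>" for i
    have g: "real (g i) \<le> u i" "u i \<le> real (g i) + 1" for i
      using u(1)[of i] by (simp_all add: g_def)
    have "g \<in> G" unfolding G_def
    proof (rule PiE_I)
      fix i
      have "real (g i) < real N" using g(1)[of i] u(2)[of i] by linarith
      then show "g i \<in> {..<N}" by simp
    qed simp
    moreover have "x \<in> Q g" using g by (simp add: Q_def u_def add.commute)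
    ultimately show "\<psi> x \<in> \<Union>?F" by blast
  qed
  moreover have "dist a b \<le> c / N" if A: "A \<in> ?F" "a \<in> A" "b \<in> A" for A a b
  proof -
    from A obtain g x y where xy: "a = \<psi> x" "b = \<psi> y" "x \<in> Q g" "y \<in> Q g" by blast
    have "\<bar>(x - y) $ i\<bar> \<le> 2 * R / N" for i
    proof -
      let ?u = "(x $ i + R) * N / (2 * R)" and ?v = "(y $ i + R) * N / (2 * R)"
      have "\<bar>?u - ?v\<bar> \<le> 1" using xy(3,4) by (auto simp: Q_def abs_le_iff) (smt (verit))+
      moreover have "?u - ?v = (x - y) $ i * (N / (2 * R))"
        using R by (simp add: field_simps)
      ultimately have "\<bar>(x - y) $ i * (N / (2 * R))\<bar> \<le> 1" by simp
      then have "\<bar>(x - y) $ i\<bar> * (N / (2 * R)) \<le> 1" using R unfolding abs_mult by simp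
      then show ?thesis using N(3) R by (simp add: field_simps)
    qed
    then have "(\<Sum>i\<in>UNIV. \<bar>(x - y) $ i\<bar>) \<le> (\<Sum>i\<in>(UNIV::'k set). 2 * R / N)"
      by (rule sum_mono)
    then have "norm (x - y) \<le> CARD('k) * (2 * R) / N"
      using norm_le_l1_cart[of "x - y"] by simp
    then have "L * norm (x - y) \<le> L * (CARD('k) * (2 * R) / N)"
      using L by (rule mult_left_mono)
    then show ?thesis
      using lipschitz_onD[OF \<psi>, of x y] by (simp add: xy dist_norm c_def)
  qed
  moreover have "real (card ?F) * (c / N) powr s \<le> \<epsilon>"
  proof -
    have "card ?F \<le> N ^ CARD('k)" using card_image_le[OF G(1)] G(2) by metis
    then have "real (card ?F) \<le> real (N ^ CARD('k))" by (simp only: of_nat_le_iff)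
    then have "real (card ?F) * (c / N) powr s \<le> real N ^ CARD('k) * (c / N) powr s"
      by (intro mult_right_mono) auto
    also have "\<dots> = c powr s * real N powr (CARD('k) - s)"
      using N(3) c by (simp add: powr_divide powr_diff powr_realpow)
    finally show ?thesis using N(1) by linarith
  qed
  ultimately show "\<exists>F d. finite F \<and> \<psi> ` {x. \<forall>i. - R \<le> x $ i \<and> x $ i < R} \<subseteq> \<Union>F \<and> 0 \<le> d \<and> d \<le> \<delta> \<and>
      (\<forall>A\<in>F. \<forall>x\<in>A. \<forall>y\<in>A. dist x y \<le> d) \<and> real (card F) * d powr s \<le> \<epsilon>"
    using N(2) c G(1) by (intro exI[of _ ?F] exI[of _ "c / N"]) auto
qed

lemma hausdorff_null_rectifiable:
  fixes E :: "'d::euclidean_space set" and s :: real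
  assumes E: "rectifiable TYPE('k::finite) E" and s: "CARD('k) < s"
  shows "hausdorff_null s E"
proof -
  obtain \<psi> :: "nat \<Rightarrow> real ^ 'k \<Rightarrow> 'd" where \<psi>: "\<And>i. \<exists>L. L-lipschitz_on UNIV (\<psi> i)"
    "E \<subseteq> (\<Union>i. range (\<psi> i))"
    using E unfolding rectifiable_def by blast
  let ?Q = "\<lambda>m::nat. {x :: real ^ 'k. \<forall>i. - real (Suc m) \<le> x $ i \<and> x $ i < real (Suc m)}"
  have "x \<in> (\<Union>m. ?Q m)" for x :: "real ^ 'k"
  proof -
    obtain m :: nat where m: "norm x < m" using reals_Archimedean2 by blast
    have "- real (Suc m) \<le> x $ i \<and> x $ i < real (Suc m)" for i
      using component_le_norm_cart[of x i] m by auto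
    then show ?thesis by blast
  qed
  then have "range (\<psi> i) \<subseteq> (\<Union>m. \<psi> i ` ?Q m)" for i
    unfolding image_UN[symmetric] by (intro image_mono subsetI)
  then have "E \<subseteq> (\<Union>i. \<Union>m. \<psi> i ` ?Q m)"
    by (intro order_trans[OF \<psi>(2)] UN_mono) simp_all
  moreover have "hausdorff_null s (\<Union>i. \<Union>m. \<psi> i ` ?Q m)"
  proof (rule hausdorff_null_UN, rule hausdorff_null_UN)
    fix i m
    obtain L where "L-lipschitz_on UNIV (\<psi> i)" using \<psi>(1) by blast
    then show "hausdorff_null s (\<psi> i ` ?Q m)"
      using s by (rule hausdorff_null_Lipschitz_cube) simp
  qed
  ultimately show ?thesis by (rule hausdorff_null_subset[rotated])
qed

lemma hausdorff_dim_rectifiable: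
  fixes E :: "'d::euclidean_space set"
  assumes "rectifiable TYPE('k::finite) E"
  shows "hausdorff_dim E \<le> of_nat CARD('k)"
proof (rule ennreal_le_epsilon)
  fix e :: real assume e: "0 < e"
  have "hausdorff_measure (CARD('k) + e) E = 0"
    by (rule hausdorff_measure_null, rule hausdorff_null_rectifiable[OF assms]) (use e in simp)
  then have "hausdorff_dim E \<le> ennreal (CARD('k) + e)"
    unfolding hausdorff_dim_def using e by (intro Inf_lower CollectI exI[of _ "CARD('k) + e"]) simp
  then show "hausdorff_dim E \<le> of_nat CARD('k) + ennreal e"
    using e by (simp add: ennreal_plus ennreal_of_nat_eq_real_of_nat)
qed

section \<open>Cyclical monotonicity of the support of an optimal plan\<close>

text \<open>The projections are declared for the Borel algebra of the product space
  itself, which is the algebra that plans carry.\<close>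

lemma measurable_fst_snd_borel [measurable]:
  "fst \<in> borel_measurable (borel :: ('a::euclidean_space \<times> 'a) measure)"
  "snd \<in> borel_measurable (borel :: ('a::euclidean_space \<times> 'a) measure)"
  by (intro borel_measurable_continuous_onI continuous_intros)+

lemma nn_integral_count_space_prod:
  assumes M: "sigma_finite_measure M" and J: "finite J"
    and f: "\<And>j. j \<in> J \<Longrightarrow> (\<lambda>z. f (j, z)) \<in> borel_measurable M"
  shows "(\<integral>\<^sup>+ w. f w \<partial>(count_space J \<Otimes>\<^sub>M M)) = (\<Sum>j\<in>J. \<integral>\<^sup>+ z. f (j, z) \<partial>M)"
proof -
  have "f \<in> borel_measurable (count_space J \<Otimes>\<^sub>M M)"
    using countable_finite[OF J] f by (rule measurable_pair_measure_countable1)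
  from sigma_finite_measure.nn_integral_fst[OF M this]
  show ?thesis by (simp add: nn_integral_count_space_finite[OF J])
qed

text \<open>Moving mass inside a plan: from each \<open>A i\<close> the fraction \<open>a i\<close> of the mass is removed, and a
  multiple of the plan that sends the sources of \<open>B i\<close> independently to the targets of \<open>A i\<close> is
  added. The result is realised as an image measure. Index \<open>i < N\<close> stands for the \<open>i\<close>-th added
  part and index \<open>N\<close> for what remains of \<open>\<pi>\<close>, so that the sum of \<open>N + 1\<close> measures becomes an integral
  over a product with a counting measure. The identity is stated with the removed mass on the
  left, so that no subtraction of extended reals occurs.\<close>

lemma exchange_plan:
  fixes \<pi> :: "('a::euclidean_space \<times> 'a) measure" and N :: nat
    and A B :: "nat \<Rightarrow> ('a \<times> 'a) set" and a k :: "nat \<Rightarrow> real"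
  assumes \<pi>: "prob_space \<pi>" "sets \<pi> = sets borel"
    and AB: "\<And>i. i < N \<Longrightarrow> A i \<in> sets borel" "\<And>i. i < N \<Longrightarrow> B i \<in> sets borel"
    and a: "\<And>i. i < N \<Longrightarrow> 0 \<le> a i" "(\<Sum>i<N. a i) \<le> 1"
  obtains \<pi>' :: "('a \<times> 'a) measure" where "sets \<pi>' = sets borel"
    "\<And>g. g \<in> borel_measurable borel \<Longrightarrow>
      (\<integral>\<^sup>+ p. g p \<partial>\<pi>') + (\<Sum>i<N. ennreal (a i) * (\<integral>\<^sup>+ p. indicator (A i) p * g p \<partial>\<pi>))
      = (\<integral>\<^sup>+ p. g p \<partial>\<pi>) + (\<Sum>i<N. ennreal (k i) *
          (\<integral>\<^sup>+ z. indicator (B i \<times> A i) z * g (fst (fst z), snd (snd z)) \<partial>(\<pi> \<Otimes>\<^sub>M \<pi>)))"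
proof -
  interpret \<pi>: prob_space \<pi> by fact
  interpret \<pi>\<pi>: pair_prob_space \<pi> \<pi> ..
  note \<pi>(2)[measurable_cong]
  \<comment> \<open>The density of the remaining part; it is at least \<open>0\<close> because the fractions sum to at
    most \<open>1\<close>, even where the sets overlap.\<close>
  define h where "h p = ennreal (1 - (\<Sum>i<N. a i * indicator (A i) p))" for p
  define W where "W w = (if fst w < N
    then ennreal (k (fst w)) * indicator (B (fst w) \<times> A (fst w)) (snd w)
    else h (fst (snd w)))" for w :: "nat \<times> ('a \<times> 'a) \<times> ('a \<times> 'a)"
  define T where "T w = (if fst w < N then (fst (fst (snd w)), snd (snd (snd w)))
    else fst (snd w))" for w :: "nat \<times> ('a \<times> 'a) \<times> ('a \<times> 'a)"
  define \<Omega> where "\<Omega> = count_space {..N} \<Otimes>\<^sub>M (\<pi> \<Otimes>\<^sub>M \<pi>)"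
  have A[measurable]: "A i \<in> sets borel" and B[measurable]: "B i \<in> sets borel" if "i < N" for i
    using AB that by auto
  have h[measurable]: "h \<in> borel_measurable borel"
    unfolding h_def by (intro measurable_compose[OF _ measurable_ennreal] borel_measurable_diff
        borel_measurable_sum borel_measurable_times borel_measurable_indicator) (auto intro: A)
  have mW: "(\<lambda>z. W (i, z)) \<in> borel_measurable (\<pi> \<Otimes>\<^sub>M \<pi>)" for i
    by (cases "i < N") (simp_all add: W_def)
  have mT: "(\<lambda>z. T (i, z)) \<in> (\<pi> \<Otimes>\<^sub>M \<pi>) \<rightarrow>\<^sub>M borel" for i
    by (cases "i < N") (simp_all add: T_def)
  have W[measurable]: "W \<in> borel_measurable \<Omega>" and T[measurable]: "T \<in> \<Omega> \<rightarrow>\<^sub>M borel"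
    unfolding \<Omega>_def by (rule measurable_pair_measure_countable1; simp add: mW mT)+
  define \<pi>' where "\<pi>' = distr (density \<Omega> W) borel T"
  show ?thesis
  proof (rule that)
    show "sets \<pi>' = sets borel" by (simp add: \<pi>'_def)
    fix g :: "'a \<times> 'a \<Rightarrow> ennreal" assume g[measurable]: "g \<in> borel_measurable borel"
    let ?R = "\<lambda>i. \<integral>\<^sup>+ z. indicator (B i \<times> A i) z * g (fst (fst z), snd (snd z)) \<partial>(\<pi> \<Otimes>\<^sub>M \<pi>)"
    have "(\<integral>\<^sup>+ p. g p \<partial>\<pi>') = (\<integral>\<^sup>+ w. g (T w) \<partial>density \<Omega> W)"
      unfolding \<pi>'_def by (rule nn_integral_distr) simp_all
    also have "\<dots> = (\<integral>\<^sup>+ w. W w * g (T w) \<partial>\<Omega>)"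
      by (rule nn_integral_density) simp_all
    also have "\<dots> = (\<Sum>i\<le>N. \<integral>\<^sup>+ z. W (i, z) * g (T (i, z)) \<partial>(\<pi> \<Otimes>\<^sub>M \<pi>))"
      unfolding \<Omega>_def
    proof (rule nn_integral_count_space_prod)
      fix i
      show "(\<lambda>z. W (i, z) * g (T (i, z))) \<in> borel_measurable (\<pi> \<Otimes>\<^sub>M \<pi>)"
        using mW mT by (intro borel_measurable_times_ennreal measurable_compose[OF mT g])
    qed (auto intro: \<pi>\<pi>.P.sigma_finite_measure_axioms)
    also have "\<dots> = (\<Sum>i<N. \<integral>\<^sup>+ z. W (i, z) * g (T (i, z)) \<partial>(\<pi> \<Otimes>\<^sub>M \<pi>))
        + (\<integral>\<^sup>+ z. W (N, z) * g (T (N, z)) \<partial>(\<pi> \<Otimes>\<^sub>M \<pi>))"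
      by (simp add: lessThan_Suc_atMost[symmetric])
    also have "(\<Sum>i<N. \<integral>\<^sup>+ z. W (i, z) * g (T (i, z)) \<partial>(\<pi> \<Otimes>\<^sub>M \<pi>))
        = (\<Sum>i<N. ennreal (k i) * ?R i)"
    proof (rule sum.cong[OF refl])
      fix i assume "i \<in> {..<N}"
      then have i: "i < N" by simp
      note A[OF i, measurable] B[OF i, measurable]
      have "(\<integral>\<^sup>+ z. W (i, z) * g (T (i, z)) \<partial>(\<pi> \<Otimes>\<^sub>M \<pi>)) = (\<integral>\<^sup>+ z. ennreal (k i) *
          (indicator (B i \<times> A i) z * g (fst (fst z), snd (snd z))) \<partial>(\<pi> \<Otimes>\<^sub>M \<pi>))"
        using i by (simp add: W_def T_def mult.assoc)
      also have "\<dots> = ennreal (k i) * ?R i"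
        by (rule nn_integral_cmult) measurable
      finally show "(\<integral>\<^sup>+ z. W (i, z) * g (T (i, z)) \<partial>(\<pi> \<Otimes>\<^sub>M \<pi>)) = ennreal (k i) * ?R i" .
    qed
    also have "(\<integral>\<^sup>+ z. W (N, z) * g (T (N, z)) \<partial>(\<pi> \<Otimes>\<^sub>M \<pi>)) = (\<integral>\<^sup>+ p. h p * g p \<partial>\<pi>)"
    proof -
      have "(\<integral>\<^sup>+ z. W (N, z) * g (T (N, z)) \<partial>(\<pi> \<Otimes>\<^sub>M \<pi>))
          = (\<integral>\<^sup>+ z. h (fst z) * g (fst z) \<partial>(\<pi> \<Otimes>\<^sub>M \<pi>))"
        by (simp add: W_def T_def)
      also have "\<dots> = (\<integral>\<^sup>+ p. \<integral>\<^sup>+ q. h p * g p \<partial>\<pi> \<partial>\<pi>)"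
        by (subst \<pi>.nn_integral_fst[symmetric]) simp_all
      finally show ?thesis by (simp add: \<pi>.emeasure_space_1)
    qed
    finally have *: "(\<integral>\<^sup>+ p. g p \<partial>\<pi>') = (\<Sum>i<N. ennreal (k i) * ?R i) + (\<integral>\<^sup>+ p. h p * g p \<partial>\<pi>)" .
    have "(\<Sum>i<N. ennreal (a i) * (\<integral>\<^sup>+ p. indicator (A i) p * g p \<partial>\<pi>))
        = (\<Sum>i<N. \<integral>\<^sup>+ p. ennreal (a i) * (indicator (A i) p * g p) \<partial>\<pi>)"
    proof (rule sum.cong[OF refl])
      fix i assume "i \<in> {..<N}"
      then have [measurable]: "A i \<in> sets borel" using A by simp
      show "ennreal (a i) * (\<integral>\<^sup>+ p. indicator (A i) p * g p \<partial>\<pi>)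
          = (\<integral>\<^sup>+ p. ennreal (a i) * (indicator (A i) p * g p) \<partial>\<pi>)"
        by (rule nn_integral_cmult[symmetric]) measurable
    qed
    also have "\<dots> = (\<integral>\<^sup>+ p. (\<Sum>i<N. ennreal (a i) * (indicator (A i) p * g p)) \<partial>\<pi>)"
    proof (rule nn_integral_sum[symmetric])
      fix i assume "i \<in> {..<N}"
      then have [measurable]: "A i \<in> sets borel" using A by simp
      show "(\<lambda>p. ennreal (a i) * (indicator (A i) p * g p)) \<in> borel_measurable \<pi>"
        by measurable
    qed
    also have "(\<integral>\<^sup>+ p. h p * g p \<partial>\<pi>) + \<dots>
        = (\<integral>\<^sup>+ p. h p * g p + (\<Sum>i<N. ennreal (a i) * (indicator (A i) p * g p)) \<partial>\<pi>)"
    proof (rule nn_integral_add[symmetric])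
      show "(\<lambda>p. \<Sum>i<N. ennreal (a i) * (indicator (A i) p * g p)) \<in> borel_measurable \<pi>"
      proof (rule borel_measurable_sum)
        fix i assume "i \<in> {..<N}"
        then have [measurable]: "A i \<in> sets borel" using A by simp
        show "(\<lambda>p. ennreal (a i) * (indicator (A i) p * g p)) \<in> borel_measurable \<pi>"
          by measurable
      qed
    qed simp
    also have "\<dots> = (\<integral>\<^sup>+ p. g p \<partial>\<pi>)"
    proof (rule nn_integral_cong)
      fix p
      let ?s = "\<Sum>i<N. a i * indicator (A i) p"
      have s: "0 \<le> ?s" "?s \<le> 1"
      proof -
        show "0 \<le> ?s" using a(1) by (intro sum_nonneg) auto
        have "?s \<le> (\<Sum>i<N. a i)" using a(1) by (intro sum_mono) (auto simp: indicator_def)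
        then show "?s \<le> 1" using a(2) by linarith
      qed
      have "(\<Sum>i<N. ennreal (a i) * (indicator (A i) p * g p))
          = (\<Sum>i<N. ennreal (a i * indicator (A i) p)) * g p"
        unfolding sum_distrib_right
        by (intro sum.cong refl) (simp add: indicator_def)
      also have "(\<Sum>i<N. ennreal (a i * indicator (A i) p)) = ennreal ?s"
        using a(1) by (intro sum_ennreal) auto
      finally have "h p * g p + (\<Sum>i<N. ennreal (a i) * (indicator (A i) p * g p))
          = (ennreal (1 - ?s) + ennreal ?s) * g p"
        by (simp add: h_def distrib_right)
      also have "ennreal (1 - ?s) + ennreal ?s = 1"
        using s by (subst ennreal_plus[symmetric]) auto
      finally show "h p * g p + (\<Sum>i<N. ennreal (a i) * (indicator (A i) p * g p)) = g p"
        by simp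
    qed
    finally show "(\<integral>\<^sup>+ p. g p \<partial>\<pi>')
        + (\<Sum>i<N. ennreal (a i) * (\<integral>\<^sup>+ p. indicator (A i) p * g p \<partial>\<pi>))
        = (\<integral>\<^sup>+ p. g p \<partial>\<pi>) + (\<Sum>i<N. ennreal (k i) * ?R i)"
      unfolding * by (simp add: ac_simps)
  qed
qed

lemma nn_integral_marginals:
  fixes \<pi> :: "('a::euclidean_space \<times> 'a) measure" and \<phi> :: "'a \<Rightarrow> ennreal"
  assumes \<pi>: "coupling \<pi> \<mu> \<nu>" and \<mu>: "sets \<mu> = sets borel" and \<nu>: "sets \<nu> = sets borel"
    and \<phi>: "\<phi> \<in> borel_measurable borel"
  shows "(\<integral>\<^sup>+ p. \<phi> (fst p) \<partial>\<pi>) = (\<integral>\<^sup>+ x. \<phi> x \<partial>\<mu>)" "(\<integral>\<^sup>+ p. \<phi> (snd p) \<partial>\<pi>) = (\<integral>\<^sup>+ x. \<phi> x \<partial>\<nu>)"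
proof -
  have s: "sets \<pi> = sets borel" using \<pi> by (simp add: coupling_def)
  then have sp: "space \<pi> = UNIV" using sets_eq_imp_space_eq by fastforce
  note s[measurable_cong] \<phi>[measurable]
  have "fst -` E = E \<times> (UNIV :: 'a set)" "snd -` E = (UNIV :: 'a set) \<times> E" for E :: "'a set"
    by auto
  then have "distr \<pi> borel fst = \<mu>" "distr \<pi> borel snd = \<nu>"
    using \<pi> \<mu> \<nu> by (auto intro!: measure_eqI simp: emeasure_distr sp coupling_def)
  moreover have "(\<integral>\<^sup>+ x. \<phi> x \<partial>distr \<pi> borel fst) = (\<integral>\<^sup>+ p. \<phi> (fst p) \<partial>\<pi>)"
    "(\<integral>\<^sup>+ x. \<phi> x \<partial>distr \<pi> borel snd) = (\<integral>\<^sup>+ p. \<phi> (snd p) \<partial>\<pi>)"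
    by (simp_all add: nn_integral_distr)
  ultimately show "(\<integral>\<^sup>+ p. \<phi> (fst p) \<partial>\<pi>) = (\<integral>\<^sup>+ x. \<phi> x \<partial>\<mu>)"
    "(\<integral>\<^sup>+ p. \<phi> (snd p) \<partial>\<pi>) = (\<integral>\<^sup>+ x. \<phi> x \<partial>\<nu>)"
    by simp_all
qed

text \<open>Finite first moments bound the cost of every coupling. Without finiteness,
  comparing the costs of two plans would say nothing about the exchanged parts.\<close>

lemma W1_cost_finite:
  assumes "\<mu> \<in> P1" "\<nu> \<in> P1" "coupling \<pi> \<mu> \<nu>"
  shows "W1_cost \<pi> < \<infinity>"
proof -
  have s[measurable_cong]: "sets \<pi> = sets borel" using assms(3) by (simp add: coupling_def)
  have "W1_cost \<pi> \<le> (\<integral>\<^sup>+ p. ennreal (norm (fst p)) + ennreal (norm (snd p)) \<partial>\<pi>)"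
    unfolding W1_cost_def
    by (intro nn_integral_mono) (auto simp: norm_triangle_ineq4 simp flip: ennreal_plus)
  also have "\<dots> = (\<integral>\<^sup>+ p. ennreal (norm (fst p)) \<partial>\<pi>) + (\<integral>\<^sup>+ p. ennreal (norm (snd p)) \<partial>\<pi>)"
    by (rule nn_integral_add) simp_all
  also have "\<dots> = (\<integral>\<^sup>+ x. ennreal (norm x) \<partial>\<mu>) + (\<integral>\<^sup>+ x. ennreal (norm x) \<partial>\<nu>)"
    using assms(1,2) by (simp add: P1_def nn_integral_marginals[OF assms(3), of "\<lambda>x. ennreal (norm x)"])
  also have "\<dots> < \<infinity>"
    using assms by (simp add: P1_def)
  finally show ?thesis .
qed

text \<open>An exchanged part inherits its first marginal from the source
  neighbourhood \<open>B\<close> and its second from the target neighbourhood \<open>A\<close>, each scaled by the mass of the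
  other.\<close>

lemma nn_integral_exchanged_marginals:
  fixes \<pi> :: "('a::euclidean_space \<times> 'a) measure"
  assumes \<pi>: "prob_space \<pi>" "sets \<pi> = sets borel"
    and [measurable]: "A \<in> sets borel" "B \<in> sets borel" "E \<in> sets borel"
  shows "(\<integral>\<^sup>+ z. indicator (B \<times> A) z * indicator (E \<times> UNIV) (fst (fst z), snd (snd z)) \<partial>(\<pi> \<Otimes>\<^sub>M \<pi>))
      = emeasure \<pi> A * (\<integral>\<^sup>+ p. indicator B p * indicator (E \<times> UNIV) p \<partial>\<pi>)"
    and "(\<integral>\<^sup>+ z. indicator (B \<times> A) z * indicator (UNIV \<times> E) (fst (fst z), snd (snd z)) \<partial>(\<pi> \<Otimes>\<^sub>M \<pi>))
      = emeasure \<pi> B * (\<integral>\<^sup>+ p. indicator A p * indicator (UNIV \<times> E) p \<partial>\<pi>)"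
proof -
  interpret \<pi>: prob_space \<pi> by fact
  note \<pi>(2)[measurable_cong]
  have EU[measurable]: "E \<times> (UNIV :: 'a set) \<in> sets borel" "(UNIV :: 'a set) \<times> E \<in> sets borel"
    unfolding borel_prod[symmetric] by measurable
  have "(\<integral>\<^sup>+ z. indicator (B \<times> A) z * indicator (E \<times> UNIV) (fst (fst z), snd (snd z)) \<partial>(\<pi> \<Otimes>\<^sub>M \<pi>))
      = (\<integral>\<^sup>+ p. \<integral>\<^sup>+ q. (indicator B p * indicator (E \<times> UNIV) p) * indicator A q \<partial>\<pi> \<partial>\<pi>)"
    by (subst \<pi>.nn_integral_fst[symmetric]) (auto simp: indicator_def intro!: nn_integral_cong)
  also have "\<dots> = emeasure \<pi> A * (\<integral>\<^sup>+ p. indicator B p * indicator (E \<times> UNIV) p \<partial>\<pi>)"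
    by (simp add: nn_integral_cmult nn_integral_multc mult.commute)
  finally show "(\<integral>\<^sup>+ z. indicator (B \<times> A) z * indicator (E \<times> UNIV) (fst (fst z), snd (snd z)) \<partial>(\<pi> \<Otimes>\<^sub>M \<pi>))
      = emeasure \<pi> A * (\<integral>\<^sup>+ p. indicator B p * indicator (E \<times> UNIV) p \<partial>\<pi>)" .
  have "(\<integral>\<^sup>+ z. indicator (B \<times> A) z * indicator (UNIV \<times> E) (fst (fst z), snd (snd z)) \<partial>(\<pi> \<Otimes>\<^sub>M \<pi>))
      = (\<integral>\<^sup>+ p. \<integral>\<^sup>+ q. indicator B p * (indicator A q * indicator (UNIV \<times> E) q) \<partial>\<pi> \<partial>\<pi>)"
    by (subst \<pi>.nn_integral_fst[symmetric]) (auto simp: indicator_def intro!: nn_integral_cong)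
  also have "\<dots> = emeasure \<pi> B * (\<integral>\<^sup>+ p. indicator A p * indicator (UNIV \<times> E) p \<partial>\<pi>)"
    by (simp add: nn_integral_cmult nn_integral_multc mult.commute)
  finally show "(\<integral>\<^sup>+ z. indicator (B \<times> A) z * indicator (UNIV \<times> E) (fst (fst z), snd (snd z)) \<partial>(\<pi> \<Otimes>\<^sub>M \<pi>))
      = emeasure \<pi> B * (\<integral>\<^sup>+ p. indicator A p * indicator (UNIV \<times> E) p \<partial>\<pi>)" .
qed

text \<open>The competitor removes the mass \<open>c\<close> from the \<open>\<epsilon>\<close>-neighbourhood \<open>A i\<close>
  of every point and returns the mass \<open>c\<close> as independent pairs with source in \<open>A (\<sigma> i)\<close> and target
  in \<open>A i\<close>. As \<open>\<sigma>\<close> is a permutation, the marginals do not change. Distances within a neighbourhood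
  are known up to \<open>2 * \<epsilon>\<close>, so the optimality of \<open>\<pi>\<close> passes to the points.\<close>

lemma optimal_plan_cyclically_monotone_approx:
  fixes \<pi> :: "('a::euclidean_space \<times> 'a) measure" and p :: "nat \<Rightarrow> 'a \<times> 'a"
  assumes opt: "optimal_plan \<pi> \<mu> \<nu>" and fin: "W1_cost \<pi> < \<infinity>"
    and p: "\<And>i. i < N \<Longrightarrow> p i \<in> msupport \<pi>" and \<sigma>: "bij_betw \<sigma> {..<N} {..<N}"
    and N: "0 < N" and \<epsilon>: "0 < \<epsilon>"
  shows "(\<Sum>i<N. norm (fst (p i) - snd (p i)) - 2 * \<epsilon>)
    \<le> (\<Sum>i<N. norm (fst (p (\<sigma> i)) - snd (p i)) + 2 * \<epsilon>)"
proof -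
  have cpl: "coupling \<pi> \<mu> \<nu>" using opt by (simp add: optimal_plan_def)
  then have \<pi>: "prob_space \<pi>" and s[measurable_cong]: "sets \<pi> = sets borel"
    by (simp_all add: coupling_def)
  interpret \<pi>: prob_space \<pi> by fact
  define A where "A i = ball (fst (p i)) \<epsilon> \<times> ball (snd (p i)) \<epsilon>" for i
  have Ao: "open (A i)" for i by (simp add: A_def open_Times)
  then have A[measurable]: "A i \<in> sets borel" for i by simp
  define m where "m i = measure \<pi> (A i)" for i
  have em: "emeasure \<pi> (A i) = ennreal (m i)" for i
    by (simp add: m_def \<pi>.emeasure_eq_measure)
  have m: "0 < m i" if "i < N" for i
  proof -
    have "p i \<in> A i" using \<epsilon> by (auto simp: A_def mem_Times_iff)
    then have "0 < emeasure \<pi> (A i)" using p[OF that] Ao by (auto simp: msupport_def)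
    then show ?thesis by (simp add: em)
  qed
  have \<sigma>N: "\<sigma> i < N" if "i < N" for i using bij_betwE[OF \<sigma>] that by auto
  \<comment> \<open>The largest mass for which the removed fractions \<open>c / m i\<close> sum to at most \<open>1\<close>.\<close>
  define c where "c = 1 / (\<Sum>i<N. 1 / m i)"
  have "0 < (\<Sum>i<N. 1 / m i)" using m N by (intro sum_pos) auto
  then have c: "0 < c" and c1: "(\<Sum>i<N. c / m i) = 1"
    by (simp_all add: c_def flip: sum_divide_distrib) (simp add: c_def sum_distrib_left[symmetric] divide_inverse)
  define k where "k i = c / (m (\<sigma> i) * m i)" for i
  have k1: "ennreal (k i) * ennreal (m i) = ennreal (c / m (\<sigma> i))"
    and k2: "ennreal (k i) * ennreal (m (\<sigma> i)) = ennreal (c / m i)" if "i < N" for i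
    using m[OF that] m[OF \<sigma>N[OF that]] c
    by (auto simp: k_def simp flip: ennreal_mult intro!: arg_cong[of _ _ ennreal])
  obtain \<pi>' :: "('a \<times> 'a) measure" where s': "sets \<pi>' = sets borel" and
    exch: "\<And>g. g \<in> borel_measurable borel \<Longrightarrow>
      (\<integral>\<^sup>+ p. g p \<partial>\<pi>') + (\<Sum>i<N. ennreal (c / m i) * (\<integral>\<^sup>+ p. indicator (A i) p * g p \<partial>\<pi>))
      = (\<integral>\<^sup>+ p. g p \<partial>\<pi>) + (\<Sum>i<N. ennreal (k i) *
        (\<integral>\<^sup>+ z. indicator (A (\<sigma> i) \<times> A i) z * g (fst (fst z), snd (snd z)) \<partial>(\<pi> \<Otimes>\<^sub>M \<pi>)))"
  proof (rule exchange_plan[of \<pi> N A "\<lambda>i. A (\<sigma> i)" "\<lambda>i. c / m i" k])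
    show "0 \<le> c / m i" if "i < N" for i using c m[OF that] by simp
  qed (use \<pi> s c1 in auto)
  note s'[measurable_cong]
  have cancel: "x = y" if "x + S = y + T" "S = T" "S \<noteq> \<infinity>" for x y S T :: ennreal
    using that ennreal_add_left_cancel[of T x y] by (simp add: add.commute)
  have S_fin: "(\<Sum>i<N. ennreal (c / m i) * (\<integral>\<^sup>+ p. indicator (A i) p * indicator F p \<partial>\<pi>)) \<noteq> \<infinity>"
    if F: "F \<in> sets borel" for F
  proof -
    have "(\<integral>\<^sup>+ p. indicator (A i) p * indicator F p \<partial>\<pi>) = ennreal (measure \<pi> (A i \<inter> F))" for i
      using F by (simp add: indicator_inter_arith[symmetric] \<pi>.emeasure_eq_measure)
    then show ?thesis by (simp add: ennreal_mult_eq_top_iff)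
  qed
  have marg: "emeasure \<pi>' (E \<times> UNIV) = emeasure \<pi> (E \<times> UNIV)"
    "emeasure \<pi>' (UNIV \<times> E) = emeasure \<pi> (UNIV \<times> E)" if E[measurable]: "E \<in> sets borel" for E
  proof -
    have EU[measurable]: "E \<times> (UNIV :: 'a set) \<in> sets borel" "(UNIV :: 'a set) \<times> E \<in> sets borel"
      unfolding borel_prod[symmetric] by measurable
    have "(\<integral>\<^sup>+ p. indicator (E \<times> UNIV) p \<partial>\<pi>') = (\<integral>\<^sup>+ p. indicator (E \<times> UNIV) p \<partial>\<pi>)"
    proof (rule cancel[OF exch _ S_fin])
      let ?I = "\<lambda>i. \<integral>\<^sup>+ p. indicator (A i) p * indicator (E \<times> UNIV) p \<partial>\<pi>"
      have "(\<Sum>i<N. ennreal (k i) * (\<integral>\<^sup>+ z. indicator (A (\<sigma> i) \<times> A i) z *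
          indicator (E \<times> UNIV) (fst (fst z), snd (snd z)) \<partial>(\<pi> \<Otimes>\<^sub>M \<pi>)))
          = (\<Sum>i<N. ennreal (c / m (\<sigma> i)) * ?I (\<sigma> i))"
        by (intro sum.cong refl)
          (simp add: nn_integral_exchanged_marginals[OF \<pi> s A A E] em k1 mult.assoc[symmetric])
      also have "\<dots> = (\<Sum>i<N. ennreal (c / m i) * ?I i)"
        by (rule sum.reindex_bij_betw[OF \<sigma>])
      finally show "(\<Sum>i<N. ennreal (c / m i) * ?I i) = (\<Sum>i<N. ennreal (k i) * (\<integral>\<^sup>+ z.
          indicator (A (\<sigma> i) \<times> A i) z * indicator (E \<times> UNIV) (fst (fst z), snd (snd z)) \<partial>(\<pi> \<Otimes>\<^sub>M \<pi>)))"
        by simp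
    qed simp_all
    then show "emeasure \<pi>' (E \<times> UNIV) = emeasure \<pi> (E \<times> UNIV)" by simp
    have "(\<integral>\<^sup>+ p. indicator (UNIV \<times> E) p \<partial>\<pi>') = (\<integral>\<^sup>+ p. indicator (UNIV \<times> E) p \<partial>\<pi>)"
    proof (rule cancel[OF exch _ S_fin])
      show "(\<Sum>i<N. ennreal (c / m i) * (\<integral>\<^sup>+ p. indicator (A i) p * indicator (UNIV \<times> E) p \<partial>\<pi>))
          = (\<Sum>i<N. ennreal (k i) * (\<integral>\<^sup>+ z. indicator (A (\<sigma> i) \<times> A i) z *
            indicator (UNIV \<times> E) (fst (fst z), snd (snd z)) \<partial>(\<pi> \<Otimes>\<^sub>M \<pi>)))"
        by (intro sum.cong refl)
          (simp add: nn_integral_exchanged_marginals[OF \<pi> s A A E] em k2 mult.assoc[symmetric])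
    qed simp_all
    then show "emeasure \<pi>' (UNIV \<times> E) = emeasure \<pi> (UNIV \<times> E)" by simp
  qed
  have sp: "space \<pi> = UNIV" "space \<pi>' = UNIV"
    using sets_eq_imp_space_eq[OF s] sets_eq_imp_space_eq[OF s'] by simp_all
  have "emeasure \<pi>' (space \<pi>') = 1"
    using marg(1)[of UNIV] \<pi>.emeasure_space_1 by (simp add: sp)
  then have "coupling \<pi>' \<mu> \<nu>"
    using cpl marg s' by (auto simp: coupling_def intro: prob_spaceI)
  then have W: "W1_cost \<pi> \<le> W1_cost \<pi>'" using opt by (simp add: optimal_plan_def)
  define g where "g q = ennreal (norm (fst q - snd q))" for q :: "'a \<times> 'a"
  have g[measurable]: "g \<in> borel_measurable borel" unfolding g_def by measurable
  have Wg: "W1_cost \<rho> = (\<integral>\<^sup>+ q. g q \<partial>\<rho>)" for \<rho> :: "('a \<times> 'a) measure"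
    by (simp add: W1_cost_def g_def case_prod_unfold)
  \<comment> \<open>Bounds for the distances before and after the exchange; the truncation at \<open>0\<close> makes
    \<open>l i\<close> compatible with extended nonnegative reals.\<close>
  define l u where "l i = max 0 (norm (fst (p i) - snd (p i)) - 2 * \<epsilon>)"
    and "u i = norm (fst (p (\<sigma> i)) - snd (p i)) + 2 * \<epsilon>" for i
  have near: "norm (x - y) \<le> norm (x' - y') + 2 * \<epsilon>"
    if "dist x x' < \<epsilon>" "dist y y' < \<epsilon>" for x y x' y' :: 'a
  proof -
    have "norm (x - y) \<le> norm (x - x') + norm (x' - y') + norm (y' - y)"
      using norm_triangle_ineq[of "x - x'" "x' - y'"] norm_triangle_ineq[of "x - y'" "y' - y"] by simp
    then show ?thesis using that by (simp add: dist_norm norm_minus_commute)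
  qed
  have lower: "ennreal (c * l i) \<le> ennreal (c / m i) * (\<integral>\<^sup>+ q. indicator (A i) q * g q \<partial>\<pi>)"
    if i: "i < N" for i
  proof -
    have "ennreal (l i) * emeasure \<pi> (A i) = (\<integral>\<^sup>+ q. ennreal (l i) * indicator (A i) q \<partial>\<pi>)"
      by (rule nn_integral_cmult_indicator[symmetric]) simp
    also have "\<dots> \<le> (\<integral>\<^sup>+ q. indicator (A i) q * g q \<partial>\<pi>)"
    proof (rule nn_integral_mono)
      fix q
      show "ennreal (l i) * indicator (A i) q \<le> indicator (A i) q * g q"
      proof (cases "q \<in> A i")
        case True
        then have "norm (fst (p i) - snd (p i)) \<le> norm (fst q - snd q) + 2 * \<epsilon>"
          by (intro near) (auto simp: A_def mem_Times_iff)
        with True show ?thesis by (auto simp: l_def g_def intro!: ennreal_leI)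
      qed simp
    qed
    finally have "ennreal (c / m i) * (ennreal (l i) * ennreal (m i))
        \<le> ennreal (c / m i) * (\<integral>\<^sup>+ q. indicator (A i) q * g q \<partial>\<pi>)"
      unfolding em by (rule mult_left_mono) simp
    moreover have "ennreal (c / m i) * (ennreal (l i) * ennreal (m i)) = ennreal (c * l i)"
    proof -
      have "0 \<le> l i" by (simp add: l_def)
      then show ?thesis using m[OF i] c by (simp flip: ennreal_mult)
    qed
    ultimately show ?thesis by simp
  qed
  have upper: "ennreal (k i) * (\<integral>\<^sup>+ z. indicator (A (\<sigma> i) \<times> A i) z * g (fst (fst z), snd (snd z)) \<partial>(\<pi> \<Otimes>\<^sub>M \<pi>))
      \<le> ennreal (c * u i)" if i: "i < N" for i
  proof -
    have "(\<integral>\<^sup>+ z. indicator (A (\<sigma> i) \<times> A i) z * g (fst (fst z), snd (snd z)) \<partial>(\<pi> \<Otimes>\<^sub>M \<pi>))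
        \<le> (\<integral>\<^sup>+ z. ennreal (u i) * indicator (A (\<sigma> i) \<times> A i) z \<partial>(\<pi> \<Otimes>\<^sub>M \<pi>))"
    proof (rule nn_integral_mono)
      fix z :: "('a \<times> 'a) \<times> ('a \<times> 'a)"
      show "indicator (A (\<sigma> i) \<times> A i) z * g (fst (fst z), snd (snd z))
          \<le> ennreal (u i) * indicator (A (\<sigma> i) \<times> A i) z"
      proof (cases "z \<in> A (\<sigma> i) \<times> A i")
        case True
        then have "norm (fst (fst z) - snd (snd z)) \<le> norm (fst (p (\<sigma> i)) - snd (p i)) + 2 * \<epsilon>"
          by (intro near) (auto simp: A_def mem_Times_iff dist_commute)
        with True show ?thesis by (auto simp: u_def g_def intro!: ennreal_leI)
      qed simp
    qed
    also have "\<dots> = ennreal (u i) * emeasure (\<pi> \<Otimes>\<^sub>M \<pi>) (A (\<sigma> i) \<times> A i)"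
      by (rule nn_integral_cmult_indicator) simp
    also have "emeasure (\<pi> \<Otimes>\<^sub>M \<pi>) (A (\<sigma> i) \<times> A i) = ennreal (m (\<sigma> i)) * ennreal (m i)"
      by (simp add: \<pi>.emeasure_pair_measure_Times em)
    finally have "ennreal (k i) * (\<integral>\<^sup>+ z. indicator (A (\<sigma> i) \<times> A i) z * g (fst (fst z), snd (snd z)) \<partial>(\<pi> \<Otimes>\<^sub>M \<pi>))
        \<le> ennreal (k i) * (ennreal (u i) * (ennreal (m (\<sigma> i)) * ennreal (m i)))"
      by (rule mult_left_mono) simp
    also have "\<dots> = ennreal (c * u i)"
    proof -
      have "0 \<le> u i" using \<epsilon> by (simp add: u_def)
      then show ?thesis using m[OF i] m[OF \<sigma>N[OF i]] c
        by (simp add: k_def flip: ennreal_mult)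
    qed
    finally show ?thesis .
  qed
  have "W1_cost \<pi> + ennreal (\<Sum>i<N. c * l i) \<le> W1_cost \<pi>' + (\<Sum>i<N. ennreal (c * l i))"
    using W c by (subst sum_ennreal) (auto simp: l_def intro: add_right_mono)
  also have "\<dots> \<le> W1_cost \<pi>' + (\<Sum>i<N. ennreal (c / m i) * (\<integral>\<^sup>+ q. indicator (A i) q * g q \<partial>\<pi>))"
    by (intro add_left_mono sum_mono lower) simp
  also have "\<dots> = W1_cost \<pi> + (\<Sum>i<N. ennreal (k i) *
      (\<integral>\<^sup>+ z. indicator (A (\<sigma> i) \<times> A i) z * g (fst (fst z), snd (snd z)) \<partial>(\<pi> \<Otimes>\<^sub>M \<pi>)))"
    unfolding Wg by (rule exch[OF g])
  also have "\<dots> \<le> W1_cost \<pi> + (\<Sum>i<N. ennreal (c * u i))"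
    by (intro add_left_mono sum_mono upper) simp
  also have "\<dots> = W1_cost \<pi> + ennreal (\<Sum>i<N. c * u i)"
    using c \<epsilon> by (subst sum_ennreal) (auto simp: u_def)
  finally have "ennreal (\<Sum>i<N. c * l i) \<le> ennreal (\<Sum>i<N. c * u i)"
    using fin by (auto simp: ennreal_add_left_cancel_le)
  moreover have "0 \<le> (\<Sum>i<N. c * u i)" using c \<epsilon> by (intro sum_nonneg) (auto simp: u_def)
  ultimately have "c * (\<Sum>i<N. l i) \<le> c * (\<Sum>i<N. u i)"
    by (simp add: sum_distrib_left)
  then have "(\<Sum>i<N. l i) \<le> (\<Sum>i<N. u i)" using c by simp
  moreover have "(\<Sum>i<N. norm (fst (p i) - snd (p i)) - 2 * \<epsilon>) \<le> (\<Sum>i<N. l i)"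
    by (intro sum_mono) (simp add: l_def)
  ultimately show ?thesis by (simp add: u_def)
qed

lemma optimal_plan_cyclically_monotone:
  fixes \<pi> :: "('a::euclidean_space \<times> 'a) measure" and p :: "nat \<Rightarrow> 'a \<times> 'a"
  assumes opt: "optimal_plan \<pi> \<mu> \<nu>" and fin: "W1_cost \<pi> < \<infinity>"
    and p: "\<And>i. i < N \<Longrightarrow> p i \<in> msupport \<pi>" and \<sigma>: "bij_betw \<sigma> {..<N} {..<N}"
  shows "(\<Sum>i<N. norm (fst (p i) - snd (p i))) \<le> (\<Sum>i<N. norm (fst (p (\<sigma> i)) - snd (p i)))"
proof (cases "N = 0")
  case False
  show ?thesis
  proof (rule field_le_epsilon)
    fix e :: real assume e: "0 < e"
    define \<epsilon> where "\<epsilon> = e / (4 * N)"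
    have "0 < \<epsilon>" using e False by (simp add: \<epsilon>_def)
    from optimal_plan_cyclically_monotone_approx[OF opt fin p \<sigma> _ this] False
    have "(\<Sum>i<N. norm (fst (p i) - snd (p i)) - 2 * \<epsilon>)
        \<le> (\<Sum>i<N. norm (fst (p (\<sigma> i)) - snd (p i)) + 2 * \<epsilon>)" by simp
    moreover have "4 * N * \<epsilon> = e" using False by (simp add: \<epsilon>_def)
    ultimately show "(\<Sum>i<N. norm (fst (p i) - snd (p i)))
        \<le> (\<Sum>i<N. norm (fst (p (\<sigma> i)) - snd (p i))) + e"
      by (simp add: sum_subtractf sum.distrib algebra_simps)
  qed
qed simp

section \<open>A potential for a cyclically monotone set\<close>

text \<open>The cost of a path from \<open>a\<close> to \<open>z\<close> in the graph with an edge of weight \<open>norm (v - w)\<close> from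
  any point \<open>v\<close> to any point \<open>w\<close>, and an additional edge of weight \<open>- norm (x - y)\<close> from \<open>x\<close> to \<open>y\<close> for
  every pair \<open>(x, y)\<close> of a given set: the list names the additional edges that are used, in order,
  and edges of the first kind connect them.\<close>

fun chain_cost :: "'a::real_normed_vector \<Rightarrow> ('a \<times> 'a) list \<Rightarrow> 'a \<Rightarrow> real" where
  "chain_cost a [] z = norm (a - z)"
| "chain_cost a (p # ps) z = norm (a - fst p) - norm (fst p - snd p) + chain_cost (snd p) ps z"

lemma chain_cost_triangle: "chain_cost a ps z \<le> chain_cost a ps w + norm (w - z)"
proof (induction ps arbitrary: a)
  case Nil
  show ?case using norm_triangle_ineq[of "a - w" "w - z"] by simp
qed simp

lemma chain_cost_snoc:
  "chain_cost a (ps @ [p]) z = chain_cost a ps (fst p) - norm (fst p - snd p) + norm (snd p - z)"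
  by (induction ps arbitrary: a) simp_all

text \<open>The link between paths and the indexed sums of cyclical monotonicity: the additional edges
  contribute the first sum, and the connections between consecutive ones the second.\<close>

lemma chain_cost_sum:
  "chain_cost a (p # ps) z + (\<Sum>i<Suc (length ps). norm (fst ((p # ps) ! i) - snd ((p # ps) ! i)))
    = norm (a - fst p) + (\<Sum>i<length ps. norm (fst (ps ! i) - snd ((p # ps) ! i)))
      + norm (snd (last (p # ps)) - z)"
proof (induction ps arbitrary: a p)
  case (Cons q ps)
  from Cons.IH[of "snd p" q] show ?case
    by (simp add: sum.lessThan_Suc_shift norm_minus_commute del: sum.lessThan_Suc)
qed simp

text \<open>Points may be repeated, as in a path that uses an edge twice. The permutation acts on the
  sources.\<close>

definition cyclically_monotone :: "('a::real_normed_vector \<times> 'a) set \<Rightarrow> bool" where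
  "cyclically_monotone S \<longleftrightarrow> (\<forall>N (p :: nat \<Rightarrow> 'a \<times> 'a) \<sigma>. (\<forall>i<N. p i \<in> S) \<longrightarrow>
     bij_betw \<sigma> {..<N} {..<N} \<longrightarrow>
     (\<Sum>i<N. norm (fst (p i) - snd (p i))) \<le> (\<Sum>i<N. norm (fst (p (\<sigma> i)) - snd (p i))))"

lemma bij_betw_cyclic_shift: "bij_betw (\<lambda>i. if i = n then 0 else Suc i) {..<Suc n} {..<Suc n}"
proof (rule bij_betw_byWitness[where f' = "\<lambda>i. if i = 0 then n else i - 1"])
qed (auto split: if_splits)

text \<open>Absence of negative cycles: by the triangle inequality, returning through \<open>a\<close> costs at least
  as much as connecting the last pair directly to the first, and the cycle so obtained is
  governed by the cyclic shift of its pairs.\<close>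

lemma chain_cost_loop_nonneg:
  assumes S: "cyclically_monotone S" and ps: "set ps \<subseteq> S"
  shows "0 \<le> chain_cost a ps a"
proof (cases ps)
  case (Cons p qs)
  let ?n = "length qs" and ?\<sigma> = "\<lambda>i. if i = length qs then 0 else Suc i"
  have "\<forall>i<Suc ?n. ps ! i \<in> S" using ps Cons by (metis length_Cons nth_mem subsetD)
  then have "(\<Sum>i<Suc ?n. norm (fst (ps ! i) - snd (ps ! i)))
      \<le> (\<Sum>i<Suc ?n. norm (fst (ps ! ?\<sigma> i) - snd (ps ! i)))"
    using S bij_betw_cyclic_shift[of ?n] unfolding cyclically_monotone_def by blast
  also have "\<dots> = (\<Sum>i<?n. norm (fst (qs ! i) - snd (ps ! i))) + norm (fst p - snd (last ps))"
    by (simp add: Cons last_conv_nth)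
  also have "norm (fst p - snd (last ps)) \<le> norm (a - fst p) + norm (snd (last ps) - a)"
    using norm_triangle_ineq[of "fst p - a" "a - snd (last ps)"] by (simp add: norm_minus_commute)
  finally show ?thesis using chain_cost_sum[of a p qs a] by (simp add: Cons)
qed simp

text \<open>The potential is the shortest-path distance from the origin. It is finite
  because there are no negative cycles, it is 1-Lipschitz because of the edges of the first kind, and it
  drops by at least \<open>norm (x - y)\<close> from \<open>x\<close> to \<open>y\<close> because a path to \<open>x\<close> can be continued along the
  additional edge.\<close>

lemma cyclically_monotone_potential:
  fixes S :: "('a::euclidean_space \<times> 'a) set"
  assumes S: "cyclically_monotone S"
  obtains f :: "'a \<Rightarrow> real" where "1-lipschitz_on UNIV f"
    "\<And>x y. (x, y) \<in> S \<Longrightarrow> f x - f y = norm (x - y)"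
proof -
  define f where "f z = (INF ps\<in>lists S. chain_cost 0 ps z)" for z :: 'a
  have lower: "- norm z \<le> chain_cost 0 ps z" if "ps \<in> lists S" for ps z
  proof -
    have "0 \<le> chain_cost z ps z"
      using that by (intro chain_cost_loop_nonneg[OF S]) auto
    moreover have "chain_cost z ps z \<le> chain_cost 0 ps z + norm z"
    proof (cases ps)
      case (Cons p qs)
      then show ?thesis using norm_triangle_ineq[of z "- fst p"] by simp
    qed simp
    ultimately show ?thesis by simp
  qed
  have bdd: "bdd_below ((\<lambda>ps. chain_cost 0 ps z) ` lists S)" for z
    using lower by (intro bdd_belowI2)
  have ne: "lists S \<noteq> {}" by auto
  have lip: "f z \<le> f w + norm (w - z)" for z w
  proof -
    have "f z - norm (w - z) \<le> chain_cost 0 ps w" if "ps \<in> lists S" for ps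
      using cINF_lower[OF bdd that, of z] chain_cost_triangle[of 0 ps z w]
      unfolding f_def by linarith
    then have "f z - norm (w - z) \<le> f w"
      unfolding f_def[of w] by (intro cINF_greatest ne)
    then show ?thesis by simp
  qed
  have step: "f y \<le> f x - norm (x - y)" if xy: "(x, y) \<in> S" for x y
  proof -
    have "f y + norm (x - y) \<le> chain_cost 0 ps x" if "ps \<in> lists S" for ps
    proof -
      have "f y \<le> chain_cost 0 (ps @ [(x, y)]) y"
        unfolding f_def using that xy by (intro cINF_lower bdd) auto
      then show ?thesis by (simp add: chain_cost_snoc)
    qed
    then have "f y + norm (x - y) \<le> f x"
      unfolding f_def[of x] by (intro cINF_greatest ne)
    then show ?thesis by simp
  qed
  show ?thesis
  proof (rule that)
    show "1-lipschitz_on UNIV f"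
    proof (rule lipschitz_onI)
      fix x y
      show "dist (f x) (f y) \<le> 1 * dist x y"
        using lip[of x y] lip[of y x] by (simp add: dist_norm norm_minus_commute abs_le_iff)
    qed simp
    show "f x - f y = norm (x - y)" if "(x, y) \<in> S" for x y
      using step[OF that] lip[of x y] by (simp add: norm_minus_commute)
  qed
qed

section \<open>Stretch sets\<close>

text \<open>For each pair of points the inequality is non-strict, so it survives the passage to the
  infimum of the admissible constants.\<close>

lemma Lip_bound:
  fixes f :: "'a::euclidean_space \<Rightarrow> real"
  assumes f: "L-lipschitz_on UNIV f"
  shows "0 \<le> Lip f" "\<bar>f x - f y\<bar> \<le> Lip f * norm (x - y)"
proof -
  let ?K = "{L. L > 0 \<and> (\<forall>x y. \<bar>f x - f y\<bar> \<le> L * norm (x - y))}"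
  have "\<bar>f x - f y\<bar> \<le> (\<bar>L\<bar> + 1) * norm (x - y)" for x y
  proof -
    have "\<bar>f x - f y\<bar> \<le> L * norm (x - y)"
      using lipschitz_onD[OF f, of x y] by (simp add: dist_norm)
    also have "\<dots> \<le> (\<bar>L\<bar> + 1) * norm (x - y)" by (intro mult_right_mono) auto
    finally show ?thesis .
  qed
  then have ne: "?K \<noteq> {}" by (auto intro!: exI[of _ "\<bar>L\<bar> + 1"])
  show "0 \<le> Lip f" unfolding Lip_def by (rule cInf_greatest[OF ne]) auto
  show "\<bar>f x - f y\<bar> \<le> Lip f * norm (x - y)"
  proof (cases "x = y")
    case False
    then have n: "0 < norm (x - y)" by simp
    have "\<bar>f x - f y\<bar> / norm (x - y) \<le> Lip f" unfolding Lip_def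
      by (rule cInf_greatest[OF ne]) (use n in \<open>auto simp: divide_le_eq\<close>)
    then show ?thesis using n by (simp add: divide_le_eq)
  qed simp
qed

lemma closed_stretched_pairs:
  fixes f :: "'a::euclidean_space \<Rightarrow> real"
  assumes fc: "continuous_on UNIV f"
  shows "closed {(x, y). \<bar>f x - f y\<bar> = c * norm (x - y)}"
proof -
  have "continuous_on UNIV (\<lambda>p. f (fst p))" "continuous_on UNIV (\<lambda>p. f (snd p))"
    by (rule continuous_on_compose2[OF fc]; auto intro: continuous_intros)+
  then have "closed {p. \<bar>f (fst p) - f (snd p)\<bar> = c * norm (fst p - snd p)}"
    by (intro closed_Collect_eq continuous_intros)
  then show ?thesis by (simp add: case_prod_unfold)
qed

lemma closed_stretch_set:
  fixes f :: "'a::euclidean_space \<Rightarrow> real"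
  assumes f: "L-lipschitz_on UNIV f"
  shows "closed (stretch_set f)"
  unfolding stretch_set_def
  by (rule closed_stretched_pairs[OF lipschitz_on_continuous_on[OF f]])

lemma msupport_subset_closed:
  assumes \<pi>: "prob_space \<pi>" "sets \<pi> = sets borel" and C: "closed C" "emeasure \<pi> C = 1"
  shows "msupport \<pi> \<subseteq> C"
proof
  interpret \<pi>: prob_space \<pi> by fact
  have sp: "space \<pi> = UNIV" using sets_eq_imp_space_eq[OF \<pi>(2)] by simp
  have "C \<in> sets \<pi>" using C(1) \<pi>(2) by simp
  then have "emeasure \<pi> (space \<pi> - C) = emeasure \<pi> (space \<pi>) - emeasure \<pi> C"
    using C(2) by (intro emeasure_compl) auto
  then have "emeasure \<pi> (- C) = 0"
    using C(2) by (simp add: sp \<pi>.emeasure_space_1[unfolded sp] Compl_eq_Diff_UNIV)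
  moreover fix x assume "x \<in> msupport \<pi>"
  ultimately show "x \<in> C" using C(1) by (force simp: msupport_def open_Compl)
qed

text \<open>Dividing by the best Lipschitz constant, which is positive for a
  nonconstant function, reduces to the case of constant \<open>1\<close>.\<close>

lemma rectifiable_stretch_set:
  fixes f :: "real ^ 'n \<Rightarrow> real"
  assumes f: "L-lipschitz_on UNIV f" and nc: "\<not> f constant_on UNIV"
  shows "rectifiable TYPE('n option) (stretch_set f)"
proof -
  have pos: "0 < Lip f"
  proof (rule ccontr)
    assume "\<not> 0 < Lip f"
    then have "Lip f = 0" using Lip_bound(1)[OF f] by simp
    then have "f x = f 0" for x using Lip_bound(2)[OF f, of x 0] by simp
    then show False using nc by (auto simp: constant_on_def)
  qed
  define g where "g x = f x / Lip f" for x
  have diff: "\<bar>g x - g y\<bar> = \<bar>f x - f y\<bar> / Lip f" for x y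
    using pos by (simp add: g_def abs_divide flip: diff_divide_distrib)
  have "1-lipschitz_on UNIV g"
    using Lip_bound(2)[OF f] pos
    by (intro lipschitz_onI) (simp_all add: dist_real_def diff dist_norm divide_le_eq mult.commute)
  then have "rectifiable TYPE('n option) {(x, y). \<bar>g x - g y\<bar> = norm (x - y)}"
    by (rule rectifiable_rays)
  moreover have "stretch_set f = {(x, y). \<bar>g x - g y\<bar> = norm (x - y)}"
    using pos by (auto simp: stretch_set_def diff divide_eq_eq mult.commute)
  ultimately show ?thesis by simp
qed

theorem theorem1:
  fixes \<mu> \<nu> :: "(real ^ 'n) measure"
    and \<pi> :: "((real ^ 'n) \<times> (real ^ 'n)) measure"
  assumes "\<mu> \<in> P1" and "\<nu> \<in> P1"
    and "optimal_plan \<pi> \<mu> \<nu>"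
  shows "(\<exists>S. closed S \<and> rectifiable TYPE('n option) S \<and> msupport \<pi> \<subseteq> S) \<and>
         (\<forall>f. kantorovich_potential \<pi> f \<longrightarrow>
            closed (stretch_set f) \<and> msupport \<pi> \<subseteq> stretch_set f \<and>
            (\<not> f constant_on UNIV \<longrightarrow> rectifiable TYPE('n option) (stretch_set f))) \<and>
         hausdorff_dim (msupport \<pi>) \<le> of_nat (CARD('n) + 1)"
proof -
  have cpl: "coupling \<pi> \<mu> \<nu>" using assms(3) by (simp add: optimal_plan_def)
  then have \<pi>: "prob_space \<pi>" "sets \<pi> = sets borel" by (simp_all add: coupling_def)
  have "cyclically_monotone (msupport \<pi>)"
    unfolding cyclically_monotone_def
    using optimal_plan_cyclically_monotone[OF assms(3) W1_cost_finite[OF assms(1,2) cpl]] by blast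
  then obtain f where f: "1-lipschitz_on UNIV f"
    "\<And>x y. (x, y) \<in> msupport \<pi> \<Longrightarrow> f x - f y = norm (x - y)"
    by (rule cyclically_monotone_potential) blast
  \<comment> \<open>\<open>S\<close> is the stretch set of \<open>f\<close> unless \<open>Lip f < 1\<close>. This can only happen when the support
    lies on the diagonal, and then \<open>S\<close> is the diagonal.\<close>
  define S where "S = {(x, y). \<bar>f x - f y\<bar> = norm (x - y)}"
  have "closed S"
    using closed_stretched_pairs[OF lipschitz_on_continuous_on[OF f(1)], of 1] by (simp add: S_def)
  moreover have S: "rectifiable TYPE('n option) S"
    unfolding S_def by (rule rectifiable_rays[OF f(1)])
  moreover have sub: "msupport \<pi> \<subseteq> S"
    using f(2) by (auto simp: S_def)
  moreover have "hausdorff_dim (msupport \<pi>) \<le> of_nat CARD('n option)"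
    using rectifiable_subset[OF S sub] by (rule hausdorff_dim_rectifiable)
  then have "hausdorff_dim (msupport \<pi>) \<le> of_nat (CARD('n) + 1)"
    by (simp add: card_UNIV_option)
  moreover have "closed (stretch_set f) \<and> msupport \<pi> \<subseteq> stretch_set f \<and>
      (\<not> f constant_on UNIV \<longrightarrow> rectifiable TYPE('n option) (stretch_set f))"
    if "kantorovich_potential \<pi> f" for f
  proof -
    from that have f: "1-lipschitz_on UNIV f" and 1: "emeasure \<pi> (stretch_set f) = 1"
      by (simp_all add: kantorovich_potential_def)
    show ?thesis
      using closed_stretch_set[OF f] msupport_subset_closed[OF \<pi> closed_stretch_set[OF f] 1]
        rectifiable_stretch_set[OF f] by blast
  qed
  ultimately show ?thesis by blast
qed

end
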